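(* For every $k\in\mathbb Z$ there exists $C_k>0$ such that for all $t\in\mathbb R$, $|\Lambda_k(t)|+|t^3\Lambda_k'(t)|+|t^4\Lambda_k''(t)|+|t^5\Lambda_k'''(t)|\le C_k$.
   Context: Let $M(a,b,\zeta)=\sum_{n\ge0}\frac{(a)_n}{(b)_n}\frac{\zeta^n}{n!}$ be Kummer's function. For $k\in\mathbb Z$ define $$\Lambda_k(t)=9^{\frac16+k}(1+t^2)^{-\frac14-\frac{3k}2}\Big[\tfrac{\Gamma(1/3)}{\Gamma(1/6-k)}M\big(-\tfrac16-k,\tfrac23,-\tfrac{t^3}{9}\big)-\tfrac{t}{9^{1/3}}\tfrac{\Gamma(-1/3)}{\Gamma(-1/6-k)}M\big(\tfrac16-k,\tfrac43,-\tfrac{t^3}{9}\big)\Big].$$ *)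

theory Defs
  imports "HOL-Analysis.Analysis"
begin

definition kummerM :: "real \<Rightarrow> real \<Rightarrow> real \<Rightarrow> real" where
  "kummerM a b z = (\<Sum>n. pochhammer a n / pochhammer b n * z ^ n / fact n)"

definition Lambda :: "int \<Rightarrow> real \<Rightarrow> real" where
  "Lambda k t = 9 powr (1/6 + real_of_int k) * (1 + t^2) powr (-1/4 - 3 * real_of_int k / 2) *
     (Gamma (1/3) / Gamma (1/6 - real_of_int k) * kummerM (-1/6 - real_of_int k) (2/3) (-(t^3) / 9)
      - t / 9 powr (1/3) * (Gamma (-1/3) / Gamma (-1/6 - real_of_int k))
          * kummerM (1/6 - real_of_int k) (4/3) (-(t^3) / 9))"

end

theory Submission
  imports Defs "HOL-Real_Asymp.Real_Asymp"
begin

text \<open>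
  With \<open>a = -1/6 - k\<close>, the bracket in \<open>\<Lambda>\<^sub>k\<close> is a function \<open>B\<^sub>a\<close> satisfying
  \<open>B\<^sub>a'' = -\<kappa> t B\<^sub>a\<^sub>+\<^sub>1\<close> and \<open>t B\<^sub>a'/3 + a B\<^sub>a = \<kappa> B\<^sub>a\<^sub>+\<^sub>1\<close>, where \<open>\<kappa> = a (a + 1/3)\<close>; in particular
  \<open>B\<^sub>a'' + t\<^sup>2 B\<^sub>a'/3 + a t B\<^sub>a = 0\<close>.  Put \<open>\<theta> = t d/dt\<close>.  The point is that \<open>B\<^sub>a\<close> and all its iterated
  \<open>\<theta>\<close>-derivatives are \<open>O(|t| powr (-3a))\<close> at both ends.  For \<open>a > 0\<close> the bound at \<open>+\<infinity>\<close> holds for every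
  solution, by a decreasing energy for \<open>t powr (3a) B\<^sub>a\<close>.  At \<open>-\<infinity>\<close> generic solutions grow like
  \<open>exp (|t|\<^sup>3/9)\<close>, but \<open>\<Gamma>(a) B\<^sub>a(-x)\<close> has the same initial values at 0 as the Laplace integral
  \<open>\<integral> exp (-zs) s powr (a-1) (1+s) powr (-a-1/3) ds\<close> over \<open>s > 0\<close> at \<open>z = x\<^sup>3/9\<close>, hence equals it,
  and this integral is at most \<open>\<Gamma>(a) z powr (-a)\<close>.  The \<open>\<theta>\<close>-derivatives follow from
  \<open>\<theta> B\<^sub>a = 3\<kappa> B\<^sub>a\<^sub>+\<^sub>1 - 3a B\<^sub>a\<close>, and nonpositive \<open>a\<close> from
  \<open>B\<^sub>a = (a + 1/3 - t\<^sup>3/9) B\<^sub>a\<^sub>+\<^sub>1 - \<theta> B\<^sub>a\<^sub>+\<^sub>1 / 3\<close>.  Finally, in \<open>\<theta> \<Lambda>\<^sub>k\<close> the leading terms cancel: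
  it is a combination of \<open>(1+t\<^sup>2) powr (3a/2) B\<^sub>a\<^sub>+\<^sub>1\<close> and \<open>(1+t\<^sup>2) powr (3a/2-1) B\<^sub>a\<close>, hence \<open>O(t powr (-2))\<close>
  together with its \<open>\<theta>\<close>-derivatives.
\<close>

section \<open>Kummer's function and contiguous relations\<close>

text \<open>The ratio test, with term ratios tending to 0. The case \<open>z = 0\<close> and
  terminating series are split off because the quotients \<open>c (Suc n) / c n\<close> need nonzero
  terms.\<close>

lemma kummerM_summable:
  fixes a b z :: real
  assumes "b > 0"
  shows "summable (\<lambda>n. pochhammer a n / (pochhammer b n * fact n) * z ^ n)"
proof (cases "z = 0")
  case True
  then show ?thesis by (intro summable_finite[of "{0}"]) auto
next
  case z: False
  show ?thesis
  proof (cases "\<exists>m. a = - of_nat m")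
    case True
    then obtain m where "a = - of_nat m" by blast
    then have "pochhammer a n = 0" if "n \<notin> {..m}" for n
      using that pochhammer_of_nat_eq_0_lemma[of m n] by auto
    then show ?thesis by (intro summable_finite[of "{..m}"]) auto
  next
    case False
    then have pa: "pochhammer a n \<noteq> 0" for n by (auto simp: pochhammer_eq_0_iff)
    have pb: "pochhammer b n > 0" for n using assms by (rule pochhammer_pos)
    define c where "c n = pochhammer a n / (pochhammer b n * fact n) * z ^ n" for n
    have c0: "c n \<noteq> 0" for n using pa[of n] pb[of n] z by (auto simp: c_def)
    have ratio: "c (Suc n) / c n = (a + n) / (b + n) * (z / (1 + n))" for n
    proof -
      have "c (Suc n) = c n * ((a + n) / (b + n) * (z / (1 + n)))"
        by (simp add: c_def pochhammer_Suc mult_ac)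
      then show ?thesis using c0[of n] by simp
    qed
    have "(\<lambda>n. (a + real n) / (b + real n) * (z / (1 + real n))) \<longlonglongrightarrow> 1 * 0"
    proof (intro tendsto_mult)
      have "((\<lambda>n. 1 + (a - b) * inverse (b + real n)) \<longlonglongrightarrow> 1 + (a - b) * 0)"
        by (intro tendsto_intros tendsto_inverse_0_at_top
            filterlim_tendsto_add_at_top[OF tendsto_const] filterlim_real_sequentially)
      moreover have "1 + (a - b) * inverse (b + real n) = (a + real n) / (b + real n)" for n
        using assms by (auto simp: field_simps add_nonneg_eq_0_iff)
      ultimately show "(\<lambda>n. (a + real n) / (b + real n)) \<longlonglongrightarrow> 1" by simp
      show "(\<lambda>n. z / (1 + real n)) \<longlonglongrightarrow> 0"
        by (intro real_tendsto_divide_at_top[OF tendsto_const]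
            filterlim_tendsto_add_at_top[OF tendsto_const] filterlim_real_sequentially)
    qed
    then have lim: "(\<lambda>n. c (Suc n) / c n) \<longlonglongrightarrow> 0" by (simp add: ratio)
    then have "(\<lambda>n. norm (c (Suc n) / c n)) \<longlonglongrightarrow> 0" by (rule tendsto_norm_zero)
    then have "eventually (\<lambda>n. norm (c (Suc n) / c n) < 1/2) sequentially"
      by (rule order_tendstoD) simp
    then obtain N where N: "norm (c (Suc n) / c n) < 1/2" if "n \<ge> N" for n
      by (auto simp: eventually_sequentially)
    have "summable c"
    proof (rule summable_ratio_test[of "1/2" N])
      fix n assume "N \<le> n"
      from N[OF this] c0[of n] show "norm (c (Suc n)) \<le> 1/2 * norm (c n)"
        by (simp add: field_simps)
    qed simp
    then show ?thesis unfolding c_def .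
  qed
qed

lemma kummerM_sums:
  assumes "b > 0"
  shows "(\<lambda>n. pochhammer a n / (pochhammer b n * fact n) * z ^ n) sums kummerM a b z"
  using summable_sums[OF kummerM_summable[OF assms]] unfolding kummerM_def
  by (simp add: field_simps)

lemma has_real_derivative_kummerM:
  assumes "b > 0"
  shows "(kummerM a b has_real_derivative a / b * kummerM (a + 1) (b + 1) z) (at z)"
proof -
  let ?c = "\<lambda>a b n. pochhammer a n / (pochhammer b n * fact n) :: real"
  have eq: "kummerM a b = (\<lambda>z. \<Sum>n. ?c a b n * z ^ n)"
    using kummerM_sums[OF assms] by (auto simp: sums_iff)
  have d: "diffs (?c a b) n = a / b * ?c (a + 1) (b + 1) n" for n
    by (simp add: diffs_def pochhammer_rec divide_simps)
  have "((\<lambda>z. \<Sum>n. ?c a b n * z ^ n) has_real_derivative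
      (\<Sum>n. diffs (?c a b) n * z ^ n)) (at z)"
    by (rule termdiffs_strong_converges_everywhere) (rule kummerM_summable[OF assms])
  moreover have "(\<Sum>n. diffs (?c a b) n * z ^ n) = a / b * kummerM (a + 1) (b + 1) z"
    unfolding d using sums_mult[OF kummerM_sums[of "b + 1" "a + 1" z], of "a / b"] assms
    by (simp add: sums_iff mult.assoc)
  ultimately show ?thesis by (simp add: eq)
qed

text \<open>The operator \<open>z\<close> d/dz multiplies the n-th term by \<open>n\<close>. With
  this series at hand, both contiguous relations below reduce to identities between Pochhammer
  symbols.\<close>

lemma kummerM_euler_sums:
  assumes "b > 0"
  shows "(\<lambda>n. real n * (pochhammer a n / (pochhammer b n * fact n)) * z ^ n) sums
    (z * (a / b * kummerM (a + 1) (b + 1) z))"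
proof -
  have "(\<lambda>n. z * (a / b * (pochhammer (a+1) n / (pochhammer (b+1) n * fact n) * z ^ n))) sums
      (z * (a / b * kummerM (a + 1) (b + 1) z))"
    by (intro sums_mult kummerM_sums) (use assms in auto)
  also have "(\<lambda>n. z * (a / b * (pochhammer (a+1) n / (pochhammer (b+1) n * fact n) * z ^ n))) =
      (\<lambda>n. real (Suc n) * (pochhammer a (Suc n) / (pochhammer b (Suc n) * fact (Suc n))) * z ^ Suc n)"
    by (rule ext) (simp add: pochhammer_rec divide_simps)
  \<comment> \<open>The term of index 0 vanishes, so undoing the shift by \<open>Suc\<close> leaves
    the sum unchanged.\<close>
  finally show ?thesis by (subst (asm) sums_Suc_iff) simp
qed

text \<open>Apply \<open>z\<close> d/dz plus \<open>a\<close> termwise: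
  \<open>(a + n) * pochhammer a n\<close> and \<open>a * pochhammer (a + 1) n\<close> are both
  \<open>pochhammer a (Suc n)\<close>.\<close>

lemma kummerM_raise_a:
  assumes "b > 0"
  shows "z * (a / b * kummerM (a + 1) (b + 1) z) + a * kummerM a b z = a * kummerM (a + 1) b z"
proof -
  have "(\<lambda>n. real n * (pochhammer a n / (pochhammer b n * fact n)) * z ^ n +
      a * (pochhammer a n / (pochhammer b n * fact n) * z ^ n)) sums
      (z * (a / b * kummerM (a + 1) (b + 1) z) + a * kummerM a b z)"
    by (intro sums_add sums_mult kummerM_sums kummerM_euler_sums assms)
  also have "(\<lambda>n. real n * (pochhammer a n / (pochhammer b n * fact n)) * z ^ n +
      a * (pochhammer a n / (pochhammer b n * fact n) * z ^ n)) =
      (\<lambda>n. a * (pochhammer (a + 1) n / (pochhammer b n * fact n) * z ^ n))" (is "?l = ?r")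
  proof
    fix n
    have "?l n = ((a + n) * pochhammer a n) / (pochhammer b n * fact n) * z ^ n"
      by (simp add: algebra_simps add_divide_distrib)
    also have "(a + n) * pochhammer a n = a * pochhammer (a + 1) n"
      using pochhammer_Suc[of a n] pochhammer_rec[of a n] by (simp add: mult.commute)
    finally show "?l n = ?r n" by simp
  qed
  finally show ?thesis
    using sums_unique2 sums_mult[OF kummerM_sums[OF assms]] by blast
qed

text \<open>Here \<open>z\<close> d/dz plus \<open>b\<close> acts on the function with lower
  parameter \<open>b + 1\<close>; the factor \<open>b + n\<close> turns
  \<open>1 / pochhammer (b + 1) n\<close> into \<open>b / pochhammer b n\<close>.\<close>

lemma kummerM_lower_b:
  assumes "b > 0"
  shows "z * (a / (b + 1) * kummerM (a + 1) (b + 2) z) + b * kummerM a (b + 1) z = b * kummerM a b z"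
proof -
  have b1: "b + 1 > 0" using assms by simp
  have b2: "b + 1 + 1 = b + 2" by simp
  have "(\<lambda>n. real n * (pochhammer a n / (pochhammer (b + 1) n * fact n)) * z ^ n +
      b * (pochhammer a n / (pochhammer (b + 1) n * fact n) * z ^ n)) sums
      (z * (a / (b + 1) * kummerM (a + 1) (b + 2) z) + b * kummerM a (b + 1) z)"
    using sums_add[OF kummerM_euler_sums[OF b1] sums_mult[OF kummerM_sums[OF b1]]]
    unfolding b2 .
  also have "(\<lambda>n. real n * (pochhammer a n / (pochhammer (b + 1) n * fact n)) * z ^ n +
      b * (pochhammer a n / (pochhammer (b + 1) n * fact n) * z ^ n)) =
      (\<lambda>n. b * (pochhammer a n / (pochhammer b n * fact n) * z ^ n))" (is "?l = ?r")
  proof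
    fix n
    have p: "pochhammer b n > 0" "pochhammer (b + 1) n > 0"
      using assms by (auto intro!: pochhammer_pos)
    have e: "(b + n) * pochhammer b n = b * pochhammer (b + 1) n"
      using pochhammer_Suc[of b n] pochhammer_rec[of b n] by (simp add: mult.commute)
    have "(b + n) / pochhammer (b + 1) n = b / pochhammer b n"
      using p e by (simp add: field_simps)
    moreover have "?l n = ((b + n) / pochhammer (b + 1) n) * (pochhammer a n / fact n * z ^ n)"
      by (simp add: algebra_simps add_divide_distrib)
    ultimately show "?l n = ?r n" by simp
  qed
  finally show ?thesis
    using sums_unique2 sums_mult[OF kummerM_sums[OF assms]] by blast
qed

text \<open>\<open>kummerU a t\<close> is Tricomi's function \<open>U(a, 2/3, z)\<close> at \<open>z = -t\<^sup>3/9\<close>,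
  continued through the branch point \<open>z = 0\<close>.\<close>

definition kummerU :: "real \<Rightarrow> real \<Rightarrow> real" where
  "kummerU a t = Gamma (1/3) / Gamma (a + 1/3) * kummerM a (2/3) (-(t^3) / 9)
     - t / 9 powr (1/3) * (Gamma (-1/3) / Gamma a) * kummerM (a + 1/3) (4/3) (-(t^3) / 9)"

text \<open>The derivative of \<open>kummerU a\<close> in collapsed form: differentiating
  \<open>t * kummerM (a + 1/3) (4/3)\<close> gives two terms, which \<open>kummerM_lower_b\<close>
  merges into the single function with lower parameter 1/3.\<close>

definition kummerU' :: "real \<Rightarrow> real \<Rightarrow> real" where
  "kummerU' a t = - (Gamma (1/3) / Gamma (a + 1/3) * (a * t^2 / 2 * kummerM (a + 1) (5/3) (-(t^3) / 9)))
     - 1 / 9 powr (1/3) * (Gamma (-1/3) / Gamma a) * kummerM (a + 1/3) (1/3) (-(t^3) / 9)"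

lemma has_real_derivative_kummerM_cube:
  assumes "b > 0"
  shows "((\<lambda>t. kummerM a b (-(t^3) / 9)) has_real_derivative
    - (t^2 / 3 * (a / b * kummerM (a + 1) (b + 1) (-(t^3) / 9)))) (at t)"
proof -
  have "((\<lambda>t::real. -(t^3) / 9) has_real_derivative - (t^2 / 3)) (at t)"
    by (auto intro!: derivative_eq_intros)
  from DERIV_chain2[OF has_real_derivative_kummerM[OF assms] this] show ?thesis
    by (simp add: mult_ac)
qed

lemma has_real_derivative_kummerU:
  "(kummerU a has_real_derivative kummerU' a t) (at t)"
proof -
  define z where "z = -(t^3) / 9"
  define c0 where "c0 = Gamma (1/3) / Gamma (a + 1/3)"
  define c1 where "c1 = 1 / 9 powr (1/3) * (Gamma (-1/3) / Gamma a)"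
  have "((\<lambda>t. c0 * kummerM a (2/3) (-(t^3) / 9) - c1 * (t * kummerM (a + 1/3) (4/3) (-(t^3) / 9)))
    has_real_derivative c0 * (- (t^2 / 3 * (a / (2/3) * kummerM (a + 1) (2/3 + 1) z)))
     - c1 * (kummerM (a + 1/3) (4/3) z + t * (- (t^2 / 3 * ((a + 1/3) / (4/3) * kummerM (a + 1/3 + 1) (4/3 + 1) z)))))
    (at t)"
    unfolding z_def by (rule derivative_eq_intros refl has_real_derivative_kummerM_cube
      | (simp; fail) | (simp add: algebra_simps eval_nat_numeral; fail))+
  \<comment> \<open>As \<open>z\<close> is a multiple of \<open>t^3\<close>, the operator
    \<open>t\<close> d/dt acts as 3 times \<open>z\<close> d/dz, which produces the shape of
    \<open>kummerM_lower_b\<close>.\<close>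
  moreover have "t * (- (t^2 / 3 * ((a + 1/3) / (4/3) * kummerM (a + 1/3 + 1) (4/3 + 1) z)))
      = 3 * (z * ((a + 1/3) / (4/3) * kummerM (a + 1/3 + 1) (4/3 + 1) z))"
    by (simp add: z_def power2_eq_square power3_eq_cube)
  moreover have "kummerM (a + 1/3) (4/3) z + 3 * (z * ((a + 1/3) / (4/3) * kummerM (a + 1/3 + 1) (4/3 + 1) z)) =
     kummerM (a + 1/3) (1/3) z"
    using kummerM_lower_b[of "1/3" z "a + 1/3"] by simp
  moreover have "(\<lambda>t. c0 * kummerM a (2/3) (-(t^3) / 9) - c1 * (t * kummerM (a + 1/3) (4/3) (-(t^3) / 9)))
     = kummerU a"
    by (rule ext) (simp add: kummerU_def c0_def c1_def)
  moreover have "c0 * (- (t^2 / 3 * (a / (2/3) * kummerM (a + 1) (2/3 + 1) z))) - c1 * kummerM (a + 1/3) (1/3) z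
     = kummerU' a t"
    by (simp add: kummerU'_def c0_def c1_def z_def)
  ultimately show ?thesis by (simp only:)
qed

text \<open>This time \<open>kummerM_lower_b\<close> collapses the derivative of
  \<open>t^2 * kummerM (a + 1) (5/3)\<close>. The functional equation of Gamma at \<open>a\<close>
  and at \<open>a + 1/3\<close>, both away from the poles, then turns the coefficients into those of
  \<open>kummerU (a + 1)\<close>.\<close>

lemma has_real_derivative_kummerU':
  assumes "a \<notin> \<int>\<^sub>\<le>\<^sub>0" "a + 1/3 \<notin> \<int>\<^sub>\<le>\<^sub>0"
  shows "(kummerU' a has_real_derivative - (a * (a + 1/3) * t * kummerU (a + 1) t)) (at t)"
proof -
  define z where "z = -(t^3) / 9"
  define c0 where "c0 = Gamma (1/3) / Gamma (a + 1/3)"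
  define c1 where "c1 = 1 / 9 powr (1/3) * (Gamma (-1/3) / Gamma a)"
  have g0: "c0 = (a + 1/3) * (Gamma (1/3) / Gamma (a + 1 + 1/3))"
    using Gamma_plus1[OF assms(2)] assms(2) by (auto simp: c0_def add_ac)
  have g1: "c1 = a * (1 / 9 powr (1/3) * (Gamma (-1/3) / Gamma (a + 1)))"
    using Gamma_plus1[OF assms(1)] assms(1) by (auto simp: c1_def)
  have "((\<lambda>t. - (c0 * (a / 2 * (t^2 * kummerM (a + 1) (5/3) (-(t^3) / 9)))) - c1 * kummerM (a + 1/3) (1/3) (-(t^3) / 9))
    has_real_derivative
     - (c0 * (a / 2 * (2 * t * kummerM (a + 1) (5/3) z + t^2 * (- (t^2 / 3 * ((a + 1) / (5/3) * kummerM (a + 1 + 1) (5/3 + 1) z))))))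
     - c1 * (- (t^2 / 3 * ((a + 1/3) / (1/3) * kummerM (a + 1/3 + 1) (1/3 + 1) z))))
    (at t)"
    unfolding z_def by (rule derivative_eq_intros refl has_real_derivative_kummerM_cube
      | (simp; fail) | (simp add: algebra_simps eval_nat_numeral; fail))+
  moreover have "t^2 * (- (t^2 / 3 * ((a + 1) / (5/3) * kummerM (a + 1 + 1) (5/3 + 1) z)))
      = 2 * t * (3/2 * (z * ((a + 1) / (5/3) * kummerM (a + 1 + 1) (5/3 + 1) z)))"
    by (simp add: z_def power2_eq_square power3_eq_cube)
  moreover have "kummerM (a + 1) (5/3) z + 3/2 * (z * ((a + 1) / (5/3) * kummerM (a + 1 + 1) (5/3 + 1) z)) =
     kummerM (a + 1) (2/3) z"
    using kummerM_lower_b[of "2/3" z "a + 1"] by simp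
  moreover have "(\<lambda>t. - (c0 * (a / 2 * (t^2 * kummerM (a + 1) (5/3) (-(t^3) / 9)))) - c1 * kummerM (a + 1/3) (1/3) (-(t^3) / 9))
     = kummerU' a"
    by (rule ext) (simp add: kummerU'_def c0_def c1_def)
  moreover have "- (c0 * (a / 2 * (2 * t * kummerM (a + 1) (2/3) z)))
     - c1 * (- (t^2 / 3 * ((a + 1/3) / (1/3) * kummerM (a + 1/3 + 1) (1/3 + 1) z)))
     = - (a * (a + 1/3) * t * kummerU (a + 1) t)"
    unfolding g0 g1 kummerU_def z_def[symmetric]
    by (simp add: algebra_simps power2_eq_square add_divide_distrib)
  ultimately show ?thesis by (simp only: distrib_left[symmetric])
qed

text \<open>On each summand \<open>t / 3\<close> d/dt is \<open>z\<close> d/dz, so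
  \<open>kummerM_raise_a\<close> applies. In the second summand the prefactor \<open>t\<close>, of
  degree 1/3 in \<open>z\<close>, contributes the extra 1/3 that its upper parameter
  \<open>a + 1/3\<close> requires.\<close>

lemma kummerU_raise:
  assumes "a \<notin> \<int>\<^sub>\<le>\<^sub>0" "a + 1/3 \<notin> \<int>\<^sub>\<le>\<^sub>0"
  shows "t * kummerU' a t / 3 + a * kummerU a t = a * (a + 1/3) * kummerU (a + 1) t"
proof -
  define z where "z = -(t^3) / 9"
  define c0 where "c0 = Gamma (1/3) / Gamma (a + 1/3)"
  define c1 where "c1 = 1 / 9 powr (1/3) * (Gamma (-1/3) / Gamma a)"
  have g0: "c0 = (a + 1/3) * (Gamma (1/3) / Gamma (a + 1 + 1/3))"
    using Gamma_plus1[OF assms(2)] assms(2) by (auto simp: c0_def add_ac)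
  have g1: "c1 = a * (1 / 9 powr (1/3) * (Gamma (-1/3) / Gamma (a + 1)))"
    using Gamma_plus1[OF assms(1)] assms(1) by (auto simp: c1_def)
  have z: "t * t^2 = -9 * z" by (simp add: z_def power2_eq_square power3_eq_cube)
  have e0: "z * (3/2 * a * kummerM (a + 1) (5/3) z) + a * kummerM a (2/3) z = a * kummerM (a + 1) (2/3) z"
    using kummerM_raise_a[of "2/3" z a] by simp
  have e1: "z * ((a + 1/3) * (3/4) * kummerM (a + 1/3 + 1) (7/3) z) + (a + 1/3) * kummerM (a + 1/3) (4/3) z
      = (a + 1/3) * kummerM (a + 1/3 + 1) (4/3) z"
    using kummerM_raise_a[of "4/3" z "a + 1/3"] by simp
  have e2: "z * ((a + 1/3) * (3/4) * kummerM (a + 1/3 + 1) (7/3) z) + 1/3 * kummerM (a + 1/3) (4/3) z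
      = 1/3 * kummerM (a + 1/3) (1/3) z"
    using kummerM_lower_b[of "1/3" z "a + 1/3"] by simp
  have e3: "1/3 * kummerM (a + 1/3) (1/3) z + a * kummerM (a + 1/3) (4/3) z = (a + 1/3) * kummerM (a + 1/3 + 1) (4/3) z"
    using e1 e2 unfolding distrib_right[of a "1/3" "kummerM (a + 1/3) (4/3) z"] by linarith
  have "t * kummerU' a t / 3 + a * kummerU a t =
     - (c0 * (a / 6 * (t * t^2) * kummerM (a + 1) (5/3) z)) - c1 * t / 3 * kummerM (a + 1/3) (1/3) z
     + a * (c0 * kummerM a (2/3) z - t * c1 * kummerM (a + 1/3) (4/3) z)"
    unfolding kummerU'_def kummerU_def z_def c0_def c1_def
    by (simp add: algebra_simps diff_divide_distrib add_divide_distrib)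
  also have "\<dots> = c0 * (z * (3/2 * a * kummerM (a + 1) (5/3) z) + a * kummerM a (2/3) z)
     - c1 * t * (1/3 * kummerM (a + 1/3) (1/3) z + a * kummerM (a + 1/3) (4/3) z)"
    unfolding z by (simp add: algebra_simps)
  also have "\<dots> = c0 * (a * kummerM (a + 1) (2/3) z) - c1 * t * ((a + 1/3) * kummerM (a + 1/3 + 1) (4/3) z)"
    unfolding e0 e3 ..
  also have "\<dots> = a * (a + 1/3) * kummerU (a + 1) t"
    unfolding g0 g1 kummerU_def z_def[symmetric]
    by (simp add: algebra_simps add_divide_distrib)
  finally show ?thesis .
qed

section \<open>The Laplace integral of Tricomi's function\<close>

text \<open>The substitution of \<open>z * s\<close> in Euler's integral. The change of variables is
  stated for absolute integrability, which follows from nonnegativity of the integrand.\<close>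

lemma has_integral_Gamma_scaled:
  fixes p z :: real
  assumes "p > 0" "z > 0"
  shows "((\<lambda>s. exp (- z * s) * s powr (p - 1)) has_integral (Gamma p * z powr (- p))) {0<..}"
proof -
  let ?f = "\<lambda>t::real. t powr (p - 1) / exp t"
  have img: "(\<lambda>s. z * s) ` {0<..} = {0<..}"
  proof (intro equalityI subsetI)
    fix y assume "y \<in> {0::real<..}"
    then show "y \<in> (\<lambda>s. z * s) ` {0<..}"
      using assms by (intro image_eqI[of _ _ "y / z"]) auto
  qed (use assms in auto)
  have "(?f has_integral Gamma p) {0<..}"
    by (subst has_integral_spike_set_eq[of _ "{0..}"])
       (use Gamma_integral_real[OF assms(1)] in \<open>auto intro: negligible_subset[of "{0}"]\<close>)
  then have f: "?f absolutely_integrable_on {0<..} \<and> integral {0<..} ?f = Gamma p"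
    by (auto simp: has_integral_iff intro!: nonnegative_absolutely_integrable_1)
  have "(\<lambda>s. \<bar>z\<bar> * ?f (z * s)) absolutely_integrable_on {0<..} \<and>
      integral {0<..} (\<lambda>s. \<bar>z\<bar> * ?f (z * s)) = Gamma p"
    by (subst has_absolute_integral_change_of_variables_1'[where g = "\<lambda>s. z * s" and g' = "\<lambda>_. z"])
       (use assms f img in \<open>auto intro!: derivative_eq_intros inj_onI\<close>)
  then have "((\<lambda>s. \<bar>z\<bar> * ?f (z * s)) has_integral Gamma p) {0<..}"
    by (auto simp: has_integral_iff set_lebesgue_integral_eq_integral)
  from has_integral_mult_left[OF this, of "z powr (- p)"]
  have "((\<lambda>s. \<bar>z\<bar> * ?f (z * s) * z powr (- p)) has_integral Gamma p * z powr (- p)) {0<..}" .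
  then show ?thesis
  proof (rule has_integral_eq[rotated])
    fix s :: real assume "s \<in> {0<..}"
    then show "\<bar>z\<bar> * ?f (z * s) * z powr (- p) = exp (- z * s) * s powr (p - 1)"
      using assms
      by (simp add: powr_mult powr_diff powr_minus exp_minus field_simps)
  qed
qed

text \<open>The substitution \<open>s = v / (1 - v)\<close> carries the unit interval to the
  half-line and Euler's Beta integral to this one.\<close>

lemma has_integral_Beta_halfline:
  fixes p q :: real
  assumes "p > 0" "q > 0"
  shows "((\<lambda>s. s powr (p - 1) * (1 + s) powr (- p - q)) has_integral Beta p q) {0<..}"
proof -
  let ?f = "\<lambda>s::real. s powr (p - 1) * (1 + s) powr (- p - q)"
  let ?g = "\<lambda>v::real. v / (1 - v)"
  let ?h = "\<lambda>t::real. t powr (p - 1) * (1 - t) powr (q - 1)"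
  have img: "?g ` {0<..<1} = {0<..}"
  proof (intro equalityI subsetI)
    fix y assume "y \<in> {0::real<..}"
    then show "y \<in> ?g ` {0<..<1}"
      by (intro image_eqI[of _ _ "y / (1 + y)"]) (auto simp: field_simps)
  qed (auto simp: field_simps)
  have inj: "inj_on ?g {0<..<1}"
    by (intro inj_onI) (auto simp: field_simps)
  have eq: "\<bar>1 / (1 - v)\<^sup>2\<bar> * ?f (?g v) = ?h v" if "v \<in> {0<..<1}" for v
  proof -
    have v: "0 < v" "v < 1" using that by auto
    have "1 + ?g v = 1 / (1 - v)" using v by (simp add: field_simps)
    then have "?f (?g v) = v powr (p - 1) * (1 - v) powr (- (p - 1)) * (1 - v) powr (p + q)"
      using v by (simp add: powr_divide powr_minus powr_diff powr_add field_simps)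
    then have "\<bar>1 / (1 - v)\<^sup>2\<bar> * ?f (?g v) =
        v powr (p - 1) * ((1 - v) powr (- 2) * (1 - v) powr (- (p - 1)) * (1 - v) powr (p + q))"
      using v by (simp add: powr_minus powr_numeral divide_inverse)
    also have "\<dots> = ?h v" by (simp flip: powr_add)
    finally show ?thesis .
  qed
  have "(?h has_integral Beta p q) {0<..<1}"
    using has_integral_Beta_real[OF assms] by (simp add: has_integral_Icc_iff_Ioo)
  then have h: "?h absolutely_integrable_on {0<..<1}" "integral {0<..<1} ?h = Beta p q"
    by (auto simp: has_integral_iff intro!: nonnegative_absolutely_integrable_1)
  have "(\<lambda>v. \<bar>1 / (1 - v)\<^sup>2\<bar> * ?f (?g v)) absolutely_integrable_on {0<..<1}"
    using h(1) eq set_integrable_cong[OF refl refl, of "{0<..<1}"] by (metis (no_types, lifting))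
  moreover have "integral {0<..<1} (\<lambda>v. \<bar>1 / (1 - v)\<^sup>2\<bar> * ?f (?g v)) = Beta p q"
    unfolding h(2)[symmetric] by (rule integral_cong) (rule eq)
  ultimately have "?f absolutely_integrable_on (?g ` {0<..<1}) \<and> integral (?g ` {0<..<1}) ?f = Beta p q"
    by (subst has_absolute_integral_change_of_variables_1'[where g = ?g and g' = "\<lambda>v. 1 / (1 - v)\<^sup>2", symmetric])
       (use inj in \<open>auto intro!: derivative_eq_intros simp: power2_eq_square field_simps\<close>)
  then show ?thesis unfolding img
    by (auto simp: has_integral_iff set_lebesgue_integral_eq_integral)
qed

text \<open>This represents Gamma(p) U(p, p + 1 - q, z). Keeping \<open>q\<close> separate from
  \<open>p\<close> makes the family closed under differentiation in \<open>z\<close>, which only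
  raises \<open>p\<close>.\<close>

definition tricomiI :: "real \<Rightarrow> real \<Rightarrow> real \<Rightarrow> real" where
  "tricomiI p q z = integral {0<..} (\<lambda>s. exp (- z * s) * s powr (p - 1) * (1 + s) powr (- q))"

lemma powr_add_one_le_1:
  fixes s q :: real
  assumes "s \<ge> 0" "q \<ge> 0"
  shows "(1 + s) powr (- q) \<le> 1"
  using powr_mono[of "- q" 0 "1 + s"] assms by simp

lemma tricomiI_absolutely_integrable:
  fixes p q z :: real
  assumes "p > 0" "q \<ge> 0" "z > 0"
  shows "(\<lambda>s. exp (- z * s) * s powr (p - 1) * (1 + s) powr (- q)) absolutely_integrable_on {0<..}"
proof (rule measurable_bounded_by_integrable_imp_absolutely_integrable)
  show "(\<lambda>s. exp (- z * s) * s powr (p - 1) * (1 + s) powr (- q)) \<in> borel_measurable (lebesgue_on {0<..})"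
    by (intro continuous_imp_measurable_on_sets_lebesgue) (auto intro!: continuous_intros)
  show "(\<lambda>s. exp (- z * s) * s powr (p - 1)) integrable_on {0<..}"
    using has_integral_Gamma_scaled[OF assms(1,3)] by (auto simp: has_integral_iff)
  fix s :: real assume "s \<in> {0<..}"
  then show "norm (exp (- z * s) * s powr (p - 1) * (1 + s) powr (- q)) \<le> exp (- z * s) * s powr (p - 1)"
    using powr_add_one_le_1[of s q] assms by (auto simp: abs_mult intro!: mult_left_le)
qed auto

lemma tricomiI_has_integral:
  assumes "p > 0" "q \<ge> 0" "z > 0"
  shows "((\<lambda>s. exp (- z * s) * s powr (p - 1) * (1 + s) powr (- q)) has_integral tricomiI p q z) {0<..}"
  using set_lebesgue_integral_eq_integral(1)[OF tricomiI_absolutely_integrable[OF assms]]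
  unfolding tricomiI_def by (rule integrable_integral)

lemma tricomiI_nonneg:
  assumes "p > 0" "q \<ge> 0" "z > 0"
  shows "0 \<le> tricomiI p q z"
  by (rule has_integral_nonneg[OF tricomiI_has_integral[OF assms]]) auto

text \<open>Dropping the factor \<open>(1 + s) powr (- q)\<close>, which is at most 1, leaves a
  Gamma integral. This is the source of the decay of \<open>kummerU\<close> at minus
  infinity.\<close>

lemma tricomiI_le:
  assumes "p > 0" "q \<ge> 0" "z > 0"
  shows "tricomiI p q z \<le> Gamma p * z powr (- p)"
proof (rule has_integral_le[OF tricomiI_has_integral[OF assms] has_integral_Gamma_scaled[OF assms(1,3)]])
  fix s :: real assume "s \<in> {0<..}"
  then show "exp (- z * s) * s powr (p - 1) * (1 + s) powr (- q) \<le> exp (- z * s) * s powr (p - 1)"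
    using powr_add_one_le_1[of s q] assms by (auto intro!: mult_left_le)
qed

text \<open>From \<open>exp u * (1 - u) \<le> 1\<close> the remainder is at most
  \<open>u * (exp u - 1)\<close>, and the second factor is compared with
  \<open>u * exp \<bar>u\<bar>\<close> according to the sign of \<open>u\<close>.\<close>

lemma exp_remainder_bound:
  fixes u :: real
  shows "\<bar>exp u - 1 - u\<bar> \<le> u\<^sup>2 * exp \<bar>u\<bar>"
proof -
  have 1: "exp u - 1 - u \<ge> 0" using exp_ge_add_one_self[of u] by linarith
  have e: "exp u * (1 - u) \<le> 1"
    using mult_left_mono[OF exp_ge_add_one_self[of "-u"], of "exp u"] by (simp add: exp_minus)
  have "exp u - 1 - u \<le> u * (exp u - 1)" using e by (simp add: algebra_simps)
  also have "\<dots> \<le> u * (u * exp \<bar>u\<bar>)"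
  proof (cases "u \<ge> 0")
    case True
    then show ?thesis using e by (intro mult_left_mono) (auto simp: algebra_simps)
  next
    case False
    have "u * exp \<bar>u\<bar> \<le> u * 1" using False by (intro mult_left_mono_neg) auto
    also have "u * 1 \<le> exp u - 1" using exp_ge_add_one_self[of u] by linarith
    finally show ?thesis using False by (intro mult_left_mono_neg) auto
  qed
  finally show ?thesis using 1 by (simp add: power2_eq_square)
qed

text \<open>Used to differentiate under the integral sign: a pointwise second-order estimate of the
  integrand integrates to exactly this hypothesis.\<close>

lemma has_real_derivative_quadratic_remainder:
  fixes f :: "real \<Rightarrow> real"
  assumes "d > 0" "\<And>y. \<bar>y - x\<bar> < d \<Longrightarrow> \<bar>f y - f x - D * (y - x)\<bar> \<le> C * (y - x)\<^sup>2"
  shows "(f has_real_derivative D) (at x)"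
proof -
  have "((\<lambda>y. (f y - f x) / (y - x) - D) \<longlongrightarrow> 0) (at x)"
  proof (rule tendsto_rabs_zero_cancel, rule tendsto_sandwich[where f = "\<lambda>_. 0" and h = "\<lambda>y. C * \<bar>y - x\<bar>"])
    have "eventually (\<lambda>y. \<bar>y - x\<bar> < d \<and> y \<noteq> x) (at x)"
      using assms(1) by (auto simp: eventually_at dist_real_def)
    then show "eventually (\<lambda>y. \<bar>(f y - f x) / (y - x) - D\<bar> \<le> C * \<bar>y - x\<bar>) (at x)"
    proof eventually_elim
      case (elim y)
      then have "\<bar>(f y - f x) / (y - x) - D\<bar> = \<bar>f y - f x - D * (y - x)\<bar> / \<bar>y - x\<bar>"
        by (simp add: field_simps flip: abs_divide)
      also have "\<dots> \<le> C * (y - x)\<^sup>2 / \<bar>y - x\<bar>"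
        using elim assms(2)[of y] by (intro divide_right_mono) auto
      also have "\<dots> = C * \<bar>y - x\<bar>"
        using elim by (simp add: field_simps power2_eq_square flip: abs_mult)
      finally show ?case .
    qed
    have "((\<lambda>y. C * \<bar>y - x\<bar>) \<longlongrightarrow> C * \<bar>x - x\<bar>) (at x)" by (intro tendsto_intros)
    then show "((\<lambda>y. C * \<bar>y - x\<bar>) \<longlongrightarrow> 0) (at x)" by simp
  qed auto
  then have "((\<lambda>y. (f y - f x) / (y - x)) \<longlongrightarrow> D) (at x)" by (simp add: LIM_zero_iff)
  then show ?thesis by (simp add: has_field_derivative_iff)
qed

text \<open>For \<open>\<bar>y - z\<bar> < z / 2\<close> the Taylor remainder of the exponential is
  at most \<open>(y - z)^2 * s^2 * exp (- (z / 2) * s)\<close>: half of the decay rate absorbs the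
  growth of \<open>exp \<bar>u\<bar>\<close>. Integration yields the constant
  \<open>tricomiI (p + 2) q (z / 2)\<close>.\<close>

lemma has_real_derivative_tricomiI:
  assumes "p > 0" "q \<ge> 0" "z > 0"
  shows "(tricomiI p q has_real_derivative - tricomiI (p + 1) q z) (at z)"
proof (rule has_real_derivative_quadratic_remainder[where d = "z / 2" and C = "tricomiI (p + 2) q (z / 2)"])
  fix y assume y: "\<bar>y - z\<bar> < z / 2"
  then have y0: "y > 0" unfolding abs_less_iff by linarith
  let ?w = "\<lambda>s::real. s powr (p - 1) * (1 + s) powr (- q)"
  let ?r = "\<lambda>s. exp (- y * s) * s powr (p - 1) * (1 + s) powr (- q)
      - exp (- z * s) * s powr (p - 1) * (1 + s) powr (- q)
      - (- (y - z)) * (exp (- z * s) * s powr (p + 1 - 1) * (1 + s) powr (- q))"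
  have I: "(?r has_integral tricomiI p q y - tricomiI p q z - (- (y - z)) * tricomiI (p + 1) q z) {0<..}"
    by (intro has_integral_diff has_integral_mult_right tricomiI_has_integral) (use assms y0 in auto)
  have J: "((\<lambda>s. (y - z)\<^sup>2 * (exp (- (z / 2) * s) * s powr (p + 2 - 1) * (1 + s) powr (- q))) has_integral
      (y - z)\<^sup>2 * tricomiI (p + 2) q (z / 2)) {0<..}"
    by (intro has_integral_mult_right tricomiI_has_integral) (use assms in auto)
  have "norm (integral {0<..} ?r) \<le> integral {0<..}
      (\<lambda>s. (y - z)\<^sup>2 * (exp (- (z / 2) * s) * s powr (p + 2 - 1) * (1 + s) powr (- q)))"
  proof (rule integral_norm_bound_integral)
    fix s :: real assume "s \<in> {0<..}"
    then have s: "s > 0" by simp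
    define u where "u = - (y - z) * s"
    have p: "s powr (p + 1 - 1) = s powr (p - 1) * s" "s powr (p + 2 - 1) = s powr (p - 1) * s\<^sup>2"
      using s powr_add[of s "p - 1" 1] powr_add[of s "p - 1" 2]
      by (simp_all add: algebra_simps)
    have ey: "exp (- y * s) = exp (- z * s) * exp u"
      unfolding u_def by (simp add: algebra_simps flip: exp_add)
    have "?r s = ?w s * (exp (- z * s) * (exp u - 1 - u))"
      unfolding ey p by (simp add: u_def algebra_simps)
    then have "norm (?r s) = ?w s * (exp (- z * s) * \<bar>exp u - 1 - u\<bar>)"
      using s by (simp add: abs_mult)
    also have "\<dots> \<le> ?w s * (exp (- z * s) * (u\<^sup>2 * exp \<bar>u\<bar>))"
      by (intro mult_left_mono exp_remainder_bound) auto
    also have "\<dots> \<le> ?w s * (u\<^sup>2 * exp (- (z / 2) * s))"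
    proof (intro mult_left_mono)
      have "\<bar>u\<bar> \<le> z / 2 * s" using y s by (simp add: u_def abs_mult abs_minus_commute)
      then have "exp (- z * s) * exp \<bar>u\<bar> \<le> exp (- (z / 2) * s)"
        by (simp flip: exp_add)
      then have "u\<^sup>2 * (exp (- z * s) * exp \<bar>u\<bar>) \<le> u\<^sup>2 * exp (- (z / 2) * s)"
        by (intro mult_left_mono) auto
      then show "exp (- z * s) * (u\<^sup>2 * exp \<bar>u\<bar>) \<le> u\<^sup>2 * exp (- (z / 2) * s)"
        by (simp add: mult_ac)
    qed auto
    also have "\<dots> = (y - z)\<^sup>2 * (exp (- (z / 2) * s) * s powr (p + 2 - 1) * (1 + s) powr (- q))"
      unfolding p u_def by (simp add: power_mult_distrib mult_ac power2_commute)
    finally show "norm (?r s) \<le> (y - z)\<^sup>2 * (exp (- (z / 2) * s) * s powr (p + 2 - 1) * (1 + s) powr (- q))" .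
  qed (use I J in \<open>auto simp: has_integral_iff\<close>)
  then show "\<bar>tricomiI p q y - tricomiI p q z - (- tricomiI (p + 1) q z) * (y - z)\<bar>
      \<le> tricomiI (p + 2) q (z / 2) * (y - z)\<^sup>2"
    unfolding integral_unique[OF I] integral_unique[OF J] real_norm_def
    by (simp add: algebra_simps)
qed (use assms in auto)

text \<open>Kummer's differential equation for the Laplace integral, with derivatives written as
  shifts of \<open>p\<close>. It says that the derivative of
  \<open>exp (- z * s) * s powr p * (1 + s) powr (1 - q)\<close> integrates to 0 over the
  half-line.\<close>

lemma tricomiI_by_parts:
  assumes "p > 0" "q \<ge> 0" "z > 0"
  shows "z * tricomiI (p + 2) q z + z * tricomiI (p + 1) q z = p * tricomiI p q z + (p + 1 - q) * tricomiI (p + 1) q z"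
proof -
  let ?F = "\<lambda>s. exp (- z * s) * s powr p * (1 + s) powr (1 - q)"
  let ?e = "\<lambda>r s. exp (- z * s) * s powr (r - 1) * (1 + s) powr (- q)"
  let ?f = "\<lambda>s. p * ?e p s + (p + 1 - q) * ?e (p + 1) s - z * ?e (p + 2) s - z * ?e (p + 1) s"
  have I: "(?f has_integral (p * tricomiI p q z + (p + 1 - q) * tricomiI (p + 1) q z
      - z * tricomiI (p + 2) q z - z * tricomiI (p + 1) q z)) {0<..}"
    by (intro has_integral_diff has_integral_add has_integral_mult_right tricomiI_has_integral)
       (use assms in auto)
  have e: "?e r absolutely_integrable_on {0<..}" if "r \<ge> p" for r
    by (rule tricomiI_absolutely_integrable) (use assms that in auto)
  have "?f absolutely_integrable_on {0<..}"
    by (intro set_integral_diff set_integral_add set_integrable_mult_right e) auto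
  \<comment> \<open>The fundamental theorem used below speaks of \<open>lborel\<close>, not of its
    completion; the integrand is Borel measurable, so integrability transfers.\<close>
  then have fi: "set_integrable lborel {0<..} ?f"
    unfolding set_integrable_def by (subst (asm) integrable_completion) auto
  have "(LBINT s=0..\<infinity>. ?f s) = 0 - 0"
  proof (rule interval_integral_FTC_integrable)
    show "(?F has_vector_derivative ?f s) (at s)" if "0 < ereal s" for s
    proof -
      have s: "s > 0" using that by (simp add: zero_ereal_def)
      have P: "s powr p = s powr (p - 1) * s" "s powr (p + 1 - 1) = s powr (p - 1) * s"
          "s powr (p + 2 - 1) = s powr (p - 1) * s\<^sup>2"
        using s powr_add[of s "p - 1" 1] powr_add[of s "p - 1" 2]
        by (simp_all add: algebra_simps)
      have Q: "(1 + s) powr (1 - q) = (1 + s) powr (- q) * (1 + s)"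
        using s powr_add[of "1 + s" "- q" 1] by (simp add: algebra_simps)
      have d1: "((\<lambda>s. exp (- z * s)) has_real_derivative exp (- z * s) * (- z)) (at s)"
        by (auto intro!: derivative_eq_intros)
      have d2: "((\<lambda>s. s powr p) has_real_derivative p * s powr (p - 1)) (at s)"
        using s by (rule has_real_derivative_powr)
      have "((\<lambda>s. 1 + s) has_real_derivative 1) (at s)" by (auto intro!: derivative_eq_intros)
      from DERIV_fun_powr[OF this, of "1 - q"] s
      have d3: "((\<lambda>s. (1 + s) powr (1 - q)) has_real_derivative (1 - q) * (1 + s) powr (- q)) (at s)"
        by simp
      have "(?F has_real_derivative (- z * exp (- z * s) * s powr p * (1 + s) powr (1 - q)
          + exp (- z * s) * (p * s powr (p - 1)) * (1 + s) powr (1 - q)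
          + exp (- z * s) * s powr p * ((1 - q) * (1 + s) powr (- q)))) (at s)"
        using DERIV_mult[OF DERIV_mult[OF d1 d2] d3] by (simp add: algebra_simps)
      moreover have "(- z * exp (- z * s) * s powr p * (1 + s) powr (1 - q)
          + exp (- z * s) * (p * s powr (p - 1)) * (1 + s) powr (1 - q)
          + exp (- z * s) * s powr p * ((1 - q) * (1 + s) powr (- q))) = ?f s"
        unfolding P Q by (simp add: algebra_simps power2_eq_square)
      ultimately show ?thesis
        by (simp add: has_real_derivative_iff_has_vector_derivative)
    qed
    show "isCont ?f s" if "0 < ereal s" for s
      using that by (intro continuous_intros) (auto simp: zero_ereal_def)
    show "set_integrable lborel (einterval 0 \<infinity>) ?f"
      using fi by (simp add: einterval_def zero_ereal_def greaterThan_def)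
    \<comment> \<open>Both boundary terms vanish: at 0 because \<open>p > 0\<close>, at infinity
      because \<open>z > 0\<close>.\<close>
    show "((?F \<circ> real_of_ereal) \<longlongrightarrow> 0) (at_right 0)"
    proof -
      have "(?F \<longlongrightarrow> 0) (at_right 0)" using assms by real_asymp
      then show ?thesis unfolding zero_ereal_def by (simp add: ereal_tendsto_simps)
    qed
    show "((?F \<circ> real_of_ereal) \<longlongrightarrow> 0) (at_left \<infinity>)"
    proof -
      have "(?F \<longlongrightarrow> 0) at_top" using assms by real_asymp
      then show ?thesis unfolding ereal_tendsto_simps .
    qed
  qed auto
  moreover have "(LBINT s=0..\<infinity>. ?f s) = integral {0<..} ?f"
    using set_borel_integral_eq_integral(2)[OF fi]
    by (simp add: interval_lebesgue_integral_def einterval_def zero_ereal_def greaterThan_def)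
  ultimately show ?thesis using I by (simp add: has_integral_iff)
qed

text \<open>The value at 0, with a rate:
  \<open>\<bar>exp (- z * s) - 1\<bar> \<le> (z * s) powr (1/6)\<close>. The exponent 1/6 is below
  1/3, so the loss of \<open>(1 + s) powr (1/6)\<close> still leaves a convergent Beta
  integral.\<close>

lemma tricomiI_tendsto_Beta:
  assumes "a > 0"
  shows "(tricomiI a (a + 1/3) \<longlongrightarrow> Beta a (1/3)) (at_right 0)"
proof -
  have bound: "\<bar>tricomiI a (a + 1/3) z - Beta a (1/3)\<bar> \<le> z powr (1/6) * Beta a (1/6)" if z: "z > 0" for z
  proof -
    let ?r = "\<lambda>s. exp (- z * s) * s powr (a - 1) * (1 + s) powr (- (a + 1/3)) - s powr (a - 1) * (1 + s) powr (- a - 1/3)"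
    let ?b = "\<lambda>s. z powr (1/6) * (s powr (a - 1) * (1 + s) powr (- a - 1/6))"
    have I: "(?r has_integral tricomiI a (a + 1/3) z - Beta a (1/3)) {0<..}"
      by (intro has_integral_diff tricomiI_has_integral has_integral_Beta_halfline) (use assms z in auto)
    have J: "(?b has_integral z powr (1/6) * Beta a (1/6)) {0<..}"
      by (intro has_integral_mult_right has_integral_Beta_halfline) (use assms in auto)
    have "norm (integral {0<..} ?r) \<le> integral {0<..} ?b"
    proof (rule integral_norm_bound_integral)
      fix s :: real assume "s \<in> {0<..}"
      then have s: "s > 0" by simp
      have "\<bar>exp (- z * s) - 1\<bar> \<le> (z * s) powr (1/6)"
      proof (cases "z * s \<le> 1")
        case True
        have "\<bar>exp (- z * s) - 1\<bar> \<le> z * s"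
          using exp_ge_add_one_self[of "- z * s"] z s by simp
        also have "z * s = (z * s) powr 1" using z s by simp
        also have "\<dots> \<le> (z * s) powr (1/6)" using z s True by (intro powr_mono') auto
        finally show ?thesis .
      next
        case False
        have "\<bar>exp (- z * s) - 1\<bar> \<le> 1" using z s by simp
        also have "1 \<le> (z * s) powr (1/6)" using False by (intro ge_one_powr_ge_zero) auto
        finally show ?thesis .
      qed
      also have "(z * s) powr (1/6) = z powr (1/6) * s powr (1/6)" using z s by (simp add: powr_mult)
      also have "\<dots> \<le> z powr (1/6) * (1 + s) powr (1/6)"
        using s by (intro mult_left_mono powr_mono2) auto
      finally have le: "\<bar>exp (- z * s) - 1\<bar> \<le> z powr (1/6) * (1 + s) powr (1/6)" .
      have "?r s = (exp (- z * s) - 1) * (s powr (a - 1) * (1 + s) powr (- a - 1/3))"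
        by (simp add: algebra_simps)
      then have "norm (?r s) = \<bar>exp (- z * s) - 1\<bar> * (s powr (a - 1) * (1 + s) powr (- a - 1/3))"
        by (simp add: abs_mult)
      also have "\<dots> \<le> z powr (1/6) * (1 + s) powr (1/6) * (s powr (a - 1) * (1 + s) powr (- a - 1/3))"
        by (intro mult_right_mono le) auto
      also have "\<dots> = z powr (1/6) * (s powr (a - 1) * ((1 + s) powr (1/6) * (1 + s) powr (- a - 1/3)))"
        by (simp only: mult_ac)
      also have "(1 + s) powr (1/6) * (1 + s) powr (- a - 1/3) = (1 + s) powr (- a - 1/6)"
        by (simp flip: powr_add add: algebra_simps)
      finally show "norm (?r s) \<le> ?b s" .
    qed (use I J in \<open>auto simp: has_integral_iff\<close>)
    then show ?thesis unfolding integral_unique[OF I] integral_unique[OF J] real_norm_def .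
  qed
  have "((\<lambda>z. tricomiI a (a + 1/3) z - Beta a (1/3)) \<longlongrightarrow> 0) (at_right 0)"
  proof (rule tendsto_rabs_zero_cancel, rule tendsto_sandwich[where f = "\<lambda>_. 0" and h = "\<lambda>z. z powr (1/6) * Beta a (1/6)"])
    show "eventually (\<lambda>z. \<bar>tricomiI a (a + 1/3) z - Beta a (1/3)\<bar> \<le> z powr (1/6) * Beta a (1/6)) (at_right 0)"
      using bound by (auto simp: eventually_at_right_less eventually_at_filter)
    have "((\<lambda>z::real. z powr (1/6)) \<longlongrightarrow> 0) (at_right 0)" by real_asymp
    from tendsto_mult_right[OF this, of "Beta a (1/6)"]
    show "((\<lambda>z. z powr (1/6) * Beta a (1/6)) \<longlongrightarrow> 0) (at_right 0)" by simp
  qed auto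
  then show ?thesis by (simp add: LIM_zero_iff)
qed

text \<open>For large \<open>s\<close> the weight
  \<open>s powr a * (1 + s) powr (- (a + 1/3))\<close> behaves like \<open>s powr (-(1/3))\<close>,
  whose Laplace transform is \<open>Gamma (2/3) * z powr (- (2/3))\<close>. The error in the weight
  is at most a multiple of \<open>s powr (-(2/3))\<close>, hence of lower order in
  \<open>z\<close>.\<close>

lemma tricomiI_deriv_tendsto:
  assumes "a > 0"
  shows "((\<lambda>z. z powr (2/3) * tricomiI (a + 1) (a + 1/3) z) \<longlongrightarrow> Gamma (2/3)) (at_right 0)"
proof -
  \<comment> \<open>An integer exponent above \<open>a + 1/3\<close> makes Bernoulli's inequality
    applicable.\<close>
  obtain n :: nat where n: "a + 1/3 \<le> n" using real_arch_simple by blast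
  define r where "r = real n"
  have r: "r \<ge> 0" by (simp add: r_def)
  have bern: "1 - x powr (a + 1/3) \<le> r * (1 - x)" if x: "0 < x" "x \<le> 1" for x :: real
  proof -
    have "x ^ n \<le> x powr (a + 1/3)"
      using x n powr_mono'[of "a + 1/3" n x] by (simp add: powr_realpow)
    moreover have "1 + n * (x - 1) \<le> (1 + (x - 1)) ^ n"
      using x by (intro Bernoulli_inequality) auto
    ultimately show ?thesis by (simp add: r_def algebra_simps)
  qed
  have bound: "\<bar>z powr (2/3) * tricomiI (a + 1) (a + 1/3) z - Gamma (2/3)\<bar> \<le> r * Gamma (1/3) * z powr (1/3)"
    if z: "z > 0" for z
  proof -
    let ?d = "\<lambda>s. exp (- z * s) * s powr (2/3 - 1) - exp (- z * s) * s powr (a + 1 - 1) * (1 + s) powr (- (a + 1/3))"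
    let ?b = "\<lambda>s. r * (exp (- z * s) * s powr (1/3 - 1))"
    have I: "(?d has_integral Gamma (2/3) * z powr (- (2/3)) - tricomiI (a + 1) (a + 1/3) z) {0<..}"
      by (intro has_integral_diff tricomiI_has_integral has_integral_Gamma_scaled) (use assms z in auto)
    have J: "(?b has_integral r * (Gamma (1/3) * z powr (- (1/3)))) {0<..}"
      by (intro has_integral_mult_right has_integral_Gamma_scaled) (use z in auto)
    have "norm (integral {0<..} ?d) \<le> integral {0<..} ?b"
    proof (rule integral_norm_bound_integral)
      fix s :: real assume "s \<in> {0<..}"
      then have s: "s > 0" by simp
      define x where "x = s / (1 + s)"
      have x: "0 < x" "x \<le> 1" "1 - x = 1 / (1 + s)" using s by (auto simp: x_def field_simps)
      have xp: "x powr (a + 1/3) \<le> 1" using x assms by (intro powr_le1) auto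
      have "s powr (a + 1 - 1) = s powr (-(1/3)) * s powr (a + 1/3)"
        by (subst powr_add[symmetric]) (simp add: add.commute)
      moreover have "x powr (a + 1/3) = s powr (a + 1/3) * (1 + s) powr (- (a + 1/3))"
        unfolding x_def powr_minus_divide using s by (subst powr_divide) auto
      ultimately have "s powr (a + 1 - 1) * (1 + s) powr (- (a + 1/3)) = s powr (-(1/3)) * x powr (a + 1/3)"
        by simp
      then have d: "?d s = exp (- z * s) * s powr (-(1/3)) * (1 - x powr (a + 1/3))"
        by (simp add: algebra_simps)
      have "norm (?d s) = exp (- z * s) * s powr (-(1/3)) * (1 - x powr (a + 1/3))"
        unfolding d using xp by (simp add: abs_mult)
      also have "\<dots> \<le> exp (- z * s) * s powr (-(1/3)) * (r * (1 - x))"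
        by (intro mult_left_mono bern x) auto
      also have "\<dots> \<le> exp (- z * s) * s powr (-(1/3)) * (r * s powr (-(1/3)))"
      proof (intro mult_left_mono)
        \<comment> \<open>Weakening \<open>1 / (1 + s)\<close> to \<open>s powr (-(1/3))\<close>
          makes the majorant a scaled Gamma integral.\<close>
        have "s powr (1/3) \<le> (1 + s) powr (1/3)" using s by (intro powr_mono2) auto
        also have "\<dots> \<le> (1 + s) powr 1" using s by (intro powr_mono) auto
        finally have "s powr (1/3) \<le> 1 + s" using s by simp
        then show "1 - x \<le> s powr (- (1/3))" unfolding x(3) powr_minus divide_inverse
          using s by simp
      qed (use r in auto)
      also have "\<dots> = r * (exp (- z * s) * (s powr (-(1/3)) * s powr (-(1/3))))" by (simp only: mult_ac)
      also have "\<dots> = ?b s" by (simp flip: powr_add)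
      finally show "norm (?d s) \<le> ?b s" .
    qed (use I J in \<open>auto simp: has_integral_iff\<close>)
    then have le: "\<bar>Gamma (2/3) * z powr (- (2/3)) - tricomiI (a + 1) (a + 1/3) z\<bar> \<le> r * (Gamma (1/3) * z powr (- (1/3)))"
      unfolding integral_unique[OF I] integral_unique[OF J] real_norm_def .
    have "z powr (2/3) * tricomiI (a + 1) (a + 1/3) z - Gamma (2/3) =
       - (z powr (2/3) * (Gamma (2/3) * z powr (- (2/3)) - tricomiI (a + 1) (a + 1/3) z))"
      using z by (simp add: powr_minus right_diff_distrib)
    then have "\<bar>z powr (2/3) * tricomiI (a + 1) (a + 1/3) z - Gamma (2/3)\<bar> =
       z powr (2/3) * \<bar>Gamma (2/3) * z powr (- (2/3)) - tricomiI (a + 1) (a + 1/3) z\<bar>"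
      by (simp add: abs_mult)
    also have "\<dots> \<le> z powr (2/3) * (r * (Gamma (1/3) * z powr (- (1/3))))"
      by (intro mult_left_mono le) auto
    also have "\<dots> = r * Gamma (1/3) * (z powr (2/3) * z powr (- (1/3)))" by (simp only: mult_ac)
    also have "\<dots> = r * Gamma (1/3) * z powr (1/3)" by (simp flip: powr_add)
    finally show ?thesis .
  qed
  have "((\<lambda>z. z powr (2/3) * tricomiI (a + 1) (a + 1/3) z - Gamma (2/3)) \<longlongrightarrow> 0) (at_right 0)"
  proof (rule tendsto_rabs_zero_cancel, rule tendsto_sandwich[where f = "\<lambda>_. 0" and h = "\<lambda>z. r * Gamma (1/3) * z powr (1/3)"])
    show "eventually (\<lambda>z. \<bar>z powr (2/3) * tricomiI (a + 1) (a + 1/3) z - Gamma (2/3)\<bar> \<le> r * Gamma (1/3) * z powr (1/3)) (at_right 0)"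
      using bound by (auto simp: eventually_at_filter)
    have "((\<lambda>z::real. z powr (1/3)) \<longlongrightarrow> 0) (at_right 0)" by real_asymp
    from tendsto_mult_left[OF this, of "r * Gamma (1/3)"]
    show "((\<lambda>z. r * Gamma (1/3) * z powr (1/3)) \<longlongrightarrow> 0) (at_right 0)" by simp
  qed auto
  then show ?thesis by (simp add: LIM_zero_iff)
qed

section \<open>Decay at both ends\<close>

lemma kummerM_0 [simp]: "kummerM a b 0 = 1"
  unfolding kummerM_def using suminf_finite[of "{0}" "\<lambda>n. pochhammer a n / pochhammer b n * 0 ^ n / fact n"]
  by simp

section \<open>Identification of \<open>kummerU\<close> on the negative half-line with the Laplace
  integral\<close>

text \<open>A Gronwall argument: \<open>E\<close> is nonincreasing on the interval from 0 to
  \<open>x\<close> and tends to 0 at the left end. Initial values enter as one-sided limits, since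
  the Laplace integral is controlled only for positive arguments.\<close>

lemma ode_zero_initial_values:
  fixes D D' :: "real \<Rightarrow> real"
  assumes D: "\<And>y. y > 0 \<Longrightarrow> (D has_real_derivative D' y) (at y)"
    and D': "\<And>y. y > 0 \<Longrightarrow> (D' has_real_derivative y\<^sup>2 / 3 * D' y + a * y * D y) (at y)"
    and lim: "(D \<longlongrightarrow> 0) (at_right 0)" "(D' \<longlongrightarrow> 0) (at_right 0)"
    and x: "x > 0"
  shows "D x = 0"
proof -
  \<comment> \<open>The part \<open>1 + \<bar>a\<bar> * x\<close> absorbs the cross term
    \<open>2 * D y * D' y * (1 + a * y)\<close>, the part \<open>x^2\<close> the damping term
    \<open>2 / 3 * y^2 * (D' y)^2\<close>.\<close>
  define K where "K = 1 + \<bar>a\<bar> * x + x\<^sup>2"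
  define E where "E y = ((D y)\<^sup>2 + (D' y)\<^sup>2) * exp (- K * y)" for y
  have dE: "(E has_real_derivative
      (2 * D y * D' y + 2 * D' y * (y\<^sup>2 / 3 * D' y + a * y * D y) - K * ((D y)\<^sup>2 + (D' y)\<^sup>2)) * exp (- K * y)) (at y)"
    if "y > 0" for y
    unfolding E_def
    by (rule derivative_eq_intros D D' that refl | simp add: algebra_simps)+
  have neg: "(2 * D y * D' y + 2 * D' y * (y\<^sup>2 / 3 * D' y + a * y * D y) - K * ((D y)\<^sup>2 + (D' y)\<^sup>2)) * exp (- K * y) \<le> 0"
    if y: "0 < y" "y \<le> x" for y
  proof -
    have am: "2 * \<bar>D y * D' y\<bar> \<le> (D y)\<^sup>2 + (D' y)\<^sup>2"
      using sum_squares_bound[of "\<bar>D y\<bar>" "\<bar>D' y\<bar>"] by (simp add: abs_mult)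
    have ay: "\<bar>1 + a * y\<bar> \<le> 1 + \<bar>a\<bar> * x"
    proof -
      have "\<bar>1 + a * y\<bar> \<le> 1 + \<bar>a\<bar> * y" using y abs_triangle_ineq[of 1 "a * y"] by (simp add: abs_mult)
      also have "\<dots> \<le> 1 + \<bar>a\<bar> * x" using y by (intro add_left_mono mult_left_mono) auto
      finally show ?thesis .
    qed
    have "2 * D y * D' y * (1 + a * y) \<le> 2 * \<bar>D y * D' y\<bar> * \<bar>1 + a * y\<bar>"
      using abs_ge_self[of "2 * D y * D' y * (1 + a * y)"] by (simp add: abs_mult)
    also have "\<dots> \<le> ((D y)\<^sup>2 + (D' y)\<^sup>2) * (1 + \<bar>a\<bar> * x)"
      by (intro mult_mono am ay) auto
    finally have 1: "2 * D y * D' y * (1 + a * y) \<le> ((D y)\<^sup>2 + (D' y)\<^sup>2) * (1 + \<bar>a\<bar> * x)" .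
    have "2 / 3 * y\<^sup>2 * (D' y)\<^sup>2 \<le> x\<^sup>2 * ((D y)\<^sup>2 + (D' y)\<^sup>2)"
    proof (intro mult_mono)
      have "y\<^sup>2 \<le> x\<^sup>2" using y by (intro power_mono) auto
      then show "2 / 3 * y\<^sup>2 \<le> x\<^sup>2" using zero_le_power2[of y] by linarith
    qed auto
    with 1 have "2 * D y * D' y + 2 * D' y * (y\<^sup>2 / 3 * D' y + a * y * D y) \<le> K * ((D y)\<^sup>2 + (D' y)\<^sup>2)"
      by (simp add: K_def algebra_simps power2_eq_square)
    then show ?thesis by (intro mult_nonpos_nonneg) auto
  qed
  have mono: "E x \<le> E y" if y: "0 < y" "y \<le> x" for y
  proof (rule DERIV_nonpos_imp_nonincreasing[OF y(2)])
    fix r assume "y \<le> r" "r \<le> x"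
    then have "0 < r" "r \<le> x" using y by auto
    then show "\<exists>d. (E has_real_derivative d) (at r) \<and> d \<le> 0" using dE neg by blast
  qed
  have "(E \<longlongrightarrow> (0\<^sup>2 + 0\<^sup>2) * exp (- K * 0)) (at_right 0)"
    unfolding E_def by (intro tendsto_intros lim)
  then have "(E \<longlongrightarrow> 0) (at_right 0)" by simp
  moreover have "eventually (\<lambda>y. E x \<le> E y) (at_right 0)"
    using eventually_at_right_less[of "0::real"] eventually_at_right_real[OF x]
    by eventually_elim (auto intro!: mono)
  ultimately have "E x \<le> 0" by (rule tendsto_lowerbound) simp
  then have "(D x)\<^sup>2 + (D' x)\<^sup>2 \<le> 0" by (simp add: E_def mult_le_0_iff)
  then show ?thesis by (simp add: sum_power2_le_zero_iff)
qed

lemma not_nonpos_Ints_of_pos: "x > (0::real) \<Longrightarrow> x \<notin> \<int>\<^sub>\<le>\<^sub>0"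
  by (auto elim!: nonpos_Ints_cases)

text \<open>Both sides solve \<open>D'' = x^2 / 3 * D' + a * x * D\<close>, and at 0 both have value
  \<open>Beta a (1/3)\<close> and slope \<open>Gamma (-1/3) / 9 powr (1/3)\<close>.\<close>

theorem kummerU_eq_tricomiI:
  assumes a: "a > 0" and x: "x > 0"
  shows "Gamma a * kummerU a (- x) = tricomiI a (a + 1/3) (x ^ 3 / 9)"
proof -
  \<comment> \<open>The index \<open>j\<close> counts derivatives in \<open>z\<close>;
    \<open>F'\<close> is the derivative of \<open>T 0\<close> in \<open>y\<close>, by the chain rule
    for \<open>z = y^3 / 9\<close>.\<close>
  define T where "T j y = tricomiI (a + j) (a + 1/3) (y ^ 3 / 9)" for j y :: real
  define F' where "F' y = - (y\<^sup>2 / 3 * T 1 y)" for y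
  define G where "G y = Gamma a * kummerU a (- y)" for y
  define G' where "G' y = - (Gamma a * kummerU' a (- y))" for y
  have a': "a \<notin> \<int>\<^sub>\<le>\<^sub>0" "a + 1/3 \<notin> \<int>\<^sub>\<le>\<^sub>0" using a by (auto intro!: not_nonpos_Ints_of_pos)
  have Ga: "Gamma a \<noteq> 0" using Gamma_real_pos[OF a] by simp
  have dT: "(T j has_real_derivative - (y\<^sup>2 / 3 * T (j + 1) y)) (at y)" if "y > 0" "j \<ge> 0" for j y
  proof -
    have "((\<lambda>y. y ^ 3 / 9) has_real_derivative y\<^sup>2 / 3) (at y)"
      by (auto intro!: derivative_eq_intros)
    moreover have "(tricomiI (a + j) (a + 1/3) has_real_derivative
        - tricomiI (a + j + 1) (a + 1/3) (y ^ 3 / 9)) (at (y ^ 3 / 9))"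
      by (rule has_real_derivative_tricomiI) (use a that in auto)
    ultimately have "((\<lambda>y. tricomiI (a + j) (a + 1/3) (y ^ 3 / 9)) has_real_derivative
        - tricomiI (a + j + 1) (a + 1/3) (y ^ 3 / 9) * (y\<^sup>2 / 3)) (at y)"
      by (rule DERIV_chain2[rotated])
    then show ?thesis unfolding T_def[abs_def] by (simp add: add.assoc mult.commute)
  qed
  have dF': "(F' has_real_derivative y\<^sup>2 / 3 * F' y + a * y * T 0 y) (at y)" if y: "y > 0" for y
  proof -
    \<comment> \<open>The coefficient 2/3 is \<open>p + 1 - q\<close> for \<open>p = a\<close> and
      \<open>q = a + 1/3\<close>.\<close>
    have parts: "y ^ 3 / 9 * T 2 y + y ^ 3 / 9 * T 1 y = a * T 0 y + 2/3 * T 1 y"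
      using tricomiI_by_parts[of a "a + 1/3" "y ^ 3 / 9"] a y by (simp add: T_def)
    have "(F' has_real_derivative - (2 * y / 3 * T 1 y) + y\<^sup>2 / 3 * (y\<^sup>2 / 3) * T 2 y) (at y)"
      unfolding F'_def
      by (rule derivative_eq_intros dT refl y | simp | simp add: algebra_simps)+
    also have "- (2 * y / 3 * T 1 y) + y\<^sup>2 / 3 * (y\<^sup>2 / 3) * T 2 y
        = y * (y ^ 3 / 9 * T 2 y) - 2 * y / 3 * T 1 y"
      by (simp add: power2_eq_square power3_eq_cube)
    also have "y ^ 3 / 9 * T 2 y = a * T 0 y + 2/3 * T 1 y - y ^ 3 / 9 * T 1 y"
      using parts by simp
    also have "y * (a * T 0 y + 2/3 * T 1 y - y ^ 3 / 9 * T 1 y) - 2 * y / 3 * T 1 y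
        = y\<^sup>2 / 3 * F' y + a * y * T 0 y"
      by (simp add: F'_def algebra_simps power2_eq_square power3_eq_cube)
    finally show ?thesis .
  qed
  have dG: "(G has_real_derivative G' y) (at y)" for y
    unfolding G_def G'_def
    by (rule derivative_eq_intros DERIV_chain2[OF has_real_derivative_kummerU] refl | simp)+
  have dG': "(G' has_real_derivative y\<^sup>2 / 3 * G' y + a * y * G y) (at y)" for y
  proof -
    have "(G' has_real_derivative - (Gamma a * (- (a * (a + 1/3) * (- y) * kummerU (a + 1) (- y)) * (- 1)))) (at y)"
      unfolding G'_def
      by (rule derivative_eq_intros DERIV_chain2[OF has_real_derivative_kummerU'[OF a']] refl | simp)+
    also have "- (Gamma a * (- (a * (a + 1/3) * (- y) * kummerU (a + 1) (- y)) * (- 1)))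
       = Gamma a * y * (a * (a + 1/3) * kummerU (a + 1) (- y))" by simp
    also have "a * (a + 1/3) * kummerU (a + 1) (- y) = - y * kummerU' a (- y) / 3 + a * kummerU a (- y)"
      using kummerU_raise[OF a', of "- y"] by simp
    also have "Gamma a * y * (- y * kummerU' a (- y) / 3 + a * kummerU a (- y)) = y\<^sup>2 / 3 * G' y + a * y * G y"
      by (simp add: G_def G'_def algebra_simps power2_eq_square)
    finally show ?thesis .
  qed
  have cube: "filterlim (\<lambda>y::real. y ^ 3 / 9) (at_right 0) (at_right 0)" by real_asymp
  have limG: "(G \<longlongrightarrow> G 0) (at_right 0)" "(G' \<longlongrightarrow> G' 0) (at_right 0)"
    using DERIV_isCont[OF dG, of 0] DERIV_isCont[OF dG', of 0]
    by (auto simp: isCont_def intro: filterlim_at_split[THEN iffD1, THEN conjunct2])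
  have G0: "G 0 = Beta a (1/3)" "G' 0 = Gamma (-1/3) / 9 powr (1/3)"
    using Ga by (simp_all add: G_def G'_def kummerU_def kummerU'_def Beta_def)
  have limT: "(T 0 \<longlongrightarrow> Beta a (1/3)) (at_right 0)"
    unfolding T_def[abs_def] using filterlim_compose[OF tricomiI_tendsto_Beta[OF a] cube] by simp
  \<comment> \<open>The slope is a limit of type 0 times infinity: \<open>y^2 / 3\<close> equals
    \<open>3 / 9 powr (1/3) * z powr (2/3)\<close>, precisely the weight in
    \<open>tricomiI_deriv_tendsto\<close>.\<close>
  have limF': "(F' \<longlongrightarrow> Gamma (-1/3) / 9 powr (1/3)) (at_right 0)"
  proof -
    have "((\<lambda>y. - (3 / 9 powr (1/3)) * ((y ^ 3 / 9) powr (2/3) * tricomiI (a + 1) (a + 1/3) (y ^ 3 / 9)))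
        \<longlongrightarrow> - (3 / 9 powr (1/3)) * Gamma (2/3)) (at_right 0)"
      by (intro tendsto_intros filterlim_compose[OF tricomiI_deriv_tendsto[OF a] cube])
    moreover have "- (3 / 9 powr (1/3)) * Gamma (2/3) = Gamma (-1/3) / (9 powr (1/3) :: real)"
    proof -
      have "(-1/3::real) \<notin> \<int>\<^sub>\<le>\<^sub>0"
      proof
        assume "(-1/3::real) \<in> \<int>\<^sub>\<le>\<^sub>0"
        then obtain n :: int where "-1/3 = real_of_int n" by (auto elim!: nonpos_Ints_cases)
        then have "real_of_int (3 * n) = real_of_int (-1)" by simp
        then have "3 * n = -1" by (simp only: of_int_eq_iff)
        then show False by presburger
      qed
      from Gamma_plus1[OF this] have "Gamma (2/3 :: real) = -1/3 * Gamma (-1/3)" by simp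
      then show ?thesis by simp
    qed
    moreover have "eventually (\<lambda>y. - (3 / 9 powr (1/3)) * ((y ^ 3 / 9) powr (2/3) * tricomiI (a + 1) (a + 1/3) (y ^ 3 / 9)) = F' y) (at_right 0)"
      using eventually_at_right_less[of "0::real"]
    proof eventually_elim
      case (elim y)
      have "(y ^ 3 / 9) powr (2/3) = (y ^ 3) powr (2/3) / 9 powr (2/3)"
        by (rule powr_divide)
      also have "(y ^ 3) powr (2/3) = (y powr 3) powr (2/3)" using elim by (subst powr_numeral) auto
      also have "\<dots> = y powr 2" by (simp add: powr_powr)
      also have "\<dots> = y\<^sup>2" using elim by (subst powr_numeral) auto
      finally have 1: "(y ^ 3 / 9) powr (2/3) = y\<^sup>2 / 9 powr (2/3)" .
      have "9 powr (1/3) * 9 powr (2/3) = (9::real)" by (simp flip: powr_add)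
      then have 2: "3 / 9 powr (1/3) * (y\<^sup>2 / 9 powr (2/3)) = y\<^sup>2 / 3"
        by (simp only: times_divide_times_eq)
      have "- (3 / 9 powr (1/3)) * ((y ^ 3 / 9) powr (2/3) * T 1 y) = - ((3 / 9 powr (1/3) * (y\<^sup>2 / 9 powr (2/3))) * T 1 y)"
        unfolding 1 by simp
      then show ?case unfolding 2 by (simp add: F'_def T_def)
    qed
    ultimately show ?thesis by (simp only:) (rule Lim_transform_eventually)
  qed
  have lim: "((\<lambda>y. T 0 y - G y) \<longlongrightarrow> Beta a (1/3) - Beta a (1/3)) (at_right 0)"
     "((\<lambda>y. F' y - G' y) \<longlongrightarrow> Gamma (-1/3) / 9 powr (1/3) - Gamma (-1/3) / 9 powr (1/3)) (at_right 0)"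
    using tendsto_diff[OF limT limG(1)] tendsto_diff[OF limF' limG(2)] unfolding G0 by blast+
  have "T 0 x - G x = 0"
  proof (rule ode_zero_initial_values[where D = "\<lambda>y. T 0 y - G y" and D' = "\<lambda>y. F' y - G' y" and a = a])
    fix y :: real assume y: "y > 0"
    show "((\<lambda>y. T 0 y - G y) has_real_derivative F' y - G' y) (at y)"
      using DERIV_diff[OF dT[OF y, of 0] dG] by (simp add: F'_def)
    show "((\<lambda>y. F' y - G' y) has_real_derivative y\<^sup>2 / 3 * (F' y - G' y) + a * y * (T 0 y - G y)) (at y)"
      by (rule DERIV_cong[OF DERIV_diff[OF dF'[OF y] dG']]) (simp add: algebra_simps diff_divide_distrib)
  qed (use lim x in auto)
  then show ?thesis by (simp add: T_def G_def)
qed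

lemma kummerU_bound_at_bot:
  assumes "a > 0"
  shows "\<exists>C. \<forall>x>1. \<bar>kummerU a (- x)\<bar> \<le> C * x powr (- 3 * a)"
proof (intro exI allI impI)
  fix x :: real assume x: "x > 1"
  have G: "Gamma a > 0" using assms by (rule Gamma_real_pos)
  have q: "a + 1/3 \<ge> 0" "x ^ 3 / 9 > 0" using assms x by auto
  have "Gamma a * \<bar>kummerU a (- x)\<bar> = \<bar>Gamma a * kummerU a (- x)\<bar>" using G by (simp add: abs_mult)
  also have "\<dots> = tricomiI a (a + 1/3) (x ^ 3 / 9)"
    using tricomiI_nonneg[OF assms q] kummerU_eq_tricomiI[OF assms, of x] x by simp
  also have "\<dots> \<le> Gamma a * (x ^ 3 / 9) powr (- a)" by (rule tricomiI_le[OF assms q])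
  finally have "\<bar>kummerU a (- x)\<bar> \<le> (x ^ 3 / 9) powr (- a)" using G by simp
  also have "\<dots> = (x powr 3) powr (- a) / 9 powr (- a)"
    using x by (subst powr_divide) (auto simp: powr_numeral)
  also have "\<dots> = 1 / 9 powr (- a) * x powr (- 3 * a)" by (simp add: powr_powr)
  finally show "\<bar>kummerU a (- x)\<bar> \<le> 1 / 9 powr (- a) * x powr (- 3 * a)" .
qed

section \<open>The lowering relation and the bound at plus infinity\<close>

text \<open>Differentiate \<open>kummerU_raise\<close> and replace the second derivative of
  \<open>kummerU a\<close> by means of \<open>has_real_derivative_kummerU'\<close>; the factor
  \<open>a + 1/3\<close> on the right collects 1/3 from the product rule and
  \<open>a\<close>.\<close>

lemma kummerU'_raise:
  assumes "a \<notin> \<int>\<^sub>\<le>\<^sub>0" "a + 1/3 \<notin> \<int>\<^sub>\<le>\<^sub>0"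
  shows "a * (a + 1/3) * kummerU' (a + 1) t =
    (a + 1/3) * kummerU' a t - a * (a + 1/3) * t\<^sup>2 / 3 * kummerU (a + 1) t"
proof (rule DERIV_unique)
  show "((\<lambda>t. a * (a + 1/3) * kummerU (a + 1) t) has_real_derivative a * (a + 1/3) * kummerU' (a + 1) t) (at t)"
    by (intro DERIV_cmult has_real_derivative_kummerU)
  have "((\<lambda>t. t * kummerU' a t / 3 + a * kummerU a t) has_real_derivative
    (kummerU' a t + t * (- (a * (a + 1/3) * t * kummerU (a + 1) t))) / 3 + a * kummerU' a t) (at t)"
    by (rule derivative_eq_intros has_real_derivative_kummerU has_real_derivative_kummerU'[OF assms] refl | simp)+
  then show "((\<lambda>t. a * (a + 1/3) * kummerU (a + 1) t) has_real_derivative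
      (a + 1/3) * kummerU' a t - a * (a + 1/3) * t\<^sup>2 / 3 * kummerU (a + 1) t) (at t)"
    unfolding kummerU_raise[OF assms] by (simp add: algebra_simps power2_eq_square add_divide_distrib diff_divide_distrib)
qed

text \<open>Eliminate \<open>kummerU' a t\<close> between \<open>kummerU_raise\<close> and
  \<open>kummerU'_raise\<close>, dividing by the nonzero numbers \<open>a + 1/3\<close> and
  \<open>a\<close>. It supplies the equation for \<open>w\<close> in the energy argument and the
  descent to nonpositive \<open>a\<close>.\<close>

lemma kummerU_lower:
  assumes "a \<notin> \<int>\<^sub>\<le>\<^sub>0" "a + 1/3 \<notin> \<int>\<^sub>\<le>\<^sub>0"
  shows "kummerU a t = (a + 1/3) * kummerU (a + 1) t - t ^ 3 / 9 * kummerU (a + 1) t - t * kummerU' (a + 1) t / 3"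
proof -
  have nz: "a \<noteq> 0" "a + 1/3 \<noteq> 0" using assms by auto
  define r where "r = a + 1/3"
  define u where "u = kummerU' a t"
  define w where "w = kummerU (a + 1) t"
  define w' where "w' = kummerU' (a + 1) t"
  have r0: "r \<noteq> 0" using nz by (simp add: r_def)
  have 1: "t * u / 3 + a * kummerU a t = a * r * w"
    using kummerU_raise[OF assms, of t] by (simp add: r_def u_def w_def)
  have 2: "a * r * w' = r * u - a * r * t\<^sup>2 / 3 * w"
    using kummerU'_raise[OF assms, of t] by (simp add: r_def u_def w_def w'_def)
  have "r * (a * w' + a * t\<^sup>2 / 3 * w - u) = 0" using 2 by (simp add: algebra_simps)
  then have u: "u = a * w' + a * t\<^sup>2 / 3 * w" using r0 by simp
  have "a * (t * w' / 3 + t ^ 3 / 9 * w + kummerU a t - r * w) = 0"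
    using 1 unfolding u by (simp add: algebra_simps power2_eq_square power3_eq_cube add_divide_distrib)
  then have "kummerU a t = r * w - t ^ 3 / 9 * w - t * w' / 3" using nz by simp
  then show ?thesis by (simp only: r_def w_def w'_def)
qed

text \<open>In the first-order system for \<open>V\<close> and \<open>W\<close> the coefficient
  \<open>- x^3 / 3\<close> damps \<open>W\<close>, while \<open>V\<close> has no growth term of its
  own. Hence the weighted energy \<open>E\<close> is nonincreasing for large \<open>x\<close>, and
  it dominates \<open>V^2\<close> because \<kappa> > 0.\<close>

lemma kummerU_bound_at_top:
  assumes "a > 0"
  shows "\<exists>C. \<forall>x>1. \<bar>kummerU a x\<bar> \<le> C * x powr (- 3 * a)"
proof -
  have a': "a \<notin> \<int>\<^sub>\<le>\<^sub>0" "a + 1/3 \<notin> \<int>\<^sub>\<le>\<^sub>0" using assms by (auto intro!: not_nonpos_Ints_of_pos)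
  define \<kappa> where "\<kappa> = a * (a + 1/3)"
  have \<kappa>: "\<kappa> > 0" using assms by (simp add: \<kappa>_def)
  \<comment> \<open>Beyond \<open>T\<close> one has
    \<open>y^3 \<ge> y \<ge> 3 * (6 * a + 1)\<close>, so the coefficient in the derivative of
    \<open>E\<close> is nonpositive.\<close>
  define T where "T = max 1 (3 * (6 * a + 1))"
  define u where "u = kummerU a"
  define w where "w = kummerU (a + 1)"
  define V where "V x = x powr (3 * a) * u x" for x
  define W where "W x = x powr (3 * a) * w x" for x
  \<comment> \<open>In \<open>x E'\<close> the cross terms cancel: \<open>x V' = 3\<kappa>W\<close> and \<open>x W' = (6a + 1 - x\<^sup>3/3)W - 3V\<close>.\<close>
  define E where "E x = \<kappa> * (W x)\<^sup>2 + (V x)\<^sup>2" for x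
  have du: "(u has_real_derivative (3 * \<kappa> * w x - 3 * a * u x) / x) (at x)" if "x > 0" for x
  proof -
    have "kummerU' a x = (3 * \<kappa> * w x - 3 * a * u x) / x"
      using kummerU_raise[OF a', of x] that by (simp add: u_def w_def \<kappa>_def field_simps)
    then show ?thesis using has_real_derivative_kummerU[of a x] by (simp add: u_def)
  qed
  have dw: "(w has_real_derivative ((3 * a + 1) * w x - x ^ 3 / 3 * w x - 3 * u x) / x) (at x)" if "x > 0" for x
  proof -
    have "kummerU' (a + 1) x = ((3 * a + 1) * w x - x ^ 3 / 3 * w x - 3 * u x) / x"
      using kummerU_lower[OF a', of x] that by (simp add: u_def w_def field_simps)
    then show ?thesis using has_real_derivative_kummerU[of "a + 1" x] by (simp add: w_def)
  qed
  have dp: "((\<lambda>x. x powr (3 * a)) has_real_derivative 3 * a * x powr (3 * a) / x) (at x)" if "x > 0" for x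
    using has_real_derivative_powr[OF that, of "3 * a"] that by (simp add: powr_diff)
  have dV: "(V has_real_derivative 3 * \<kappa> * W x / x) (at x)" if "x > 0" for x
    unfolding V_def[abs_def] W_def
    by (rule DERIV_cong[OF DERIV_mult[OF dp[OF that] du[OF that]]])
      (simp add: algebra_simps diff_divide_distrib)
  have dW: "(W has_real_derivative ((6 * a + 1 - x ^ 3 / 3) * W x - 3 * V x) / x) (at x)" if "x > 0" for x
    unfolding W_def[abs_def] V_def
    by (rule DERIV_cong[OF DERIV_mult[OF dp[OF that] dw[OF that]]])
      (simp add: algebra_simps diff_divide_distrib add_divide_distrib)
  have dE: "(E has_real_derivative 2 * \<kappa> * (6 * a + 1 - x ^ 3 / 3) * (W x)\<^sup>2 / x) (at x)" if "x > 0" for x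
  proof -
    have "(E has_real_derivative \<kappa> * (2 * W x * dw) + 2 * V x * dv) (at x)"
      if "(W has_real_derivative dw) (at x)" "(V has_real_derivative dv) (at x)" for dv dw
      unfolding E_def[abs_def] power2_eq_square
      by (rule DERIV_cong[OF DERIV_add[OF DERIV_cmult[OF DERIV_mult[OF that(1,1)]] DERIV_mult[OF that(2,2)]]])
        (simp add: algebra_simps)
    from this[OF dW[OF that] dV[OF that]]
    have "(E has_real_derivative
        \<kappa> * (2 * W x * (((6 * a + 1 - x ^ 3 / 3) * W x - 3 * V x) / x)) + 2 * V x * (3 * \<kappa> * W x / x)) (at x)" .
    also have "\<kappa> * (2 * W x * (((6 * a + 1 - x ^ 3 / 3) * W x - 3 * V x) / x)) + 2 * V x * (3 * \<kappa> * W x / x)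
        = (\<kappa> * (2 * W x * ((6 * a + 1 - x ^ 3 / 3) * W x - 3 * V x)) + 2 * V x * (3 * \<kappa> * W x)) / x"
      by (simp add: add_divide_distrib)
    also have "\<kappa> * (2 * W x * ((6 * a + 1 - x ^ 3 / 3) * W x - 3 * V x)) + 2 * V x * (3 * \<kappa> * W x)
        = 2 * \<kappa> * (6 * a + 1 - x ^ 3 / 3) * (W x)\<^sup>2" by algebra
    finally show ?thesis .
  qed
  have mono: "E x \<le> E T" if "x \<ge> T" for x
  proof (rule DERIV_nonpos_imp_nonincreasing[OF that])
    fix y assume y: "T \<le> y" "y \<le> x"
    have y1: "y \<ge> 1" "y \<ge> 3 * (6 * a + 1)" using y by (auto simp: T_def)
    have "y \<le> y ^ 3" using power_increasing[of 1 3 y] y1 by simp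
    with y1 have "3 * (6 * a + 1) \<le> y ^ 3" by (meson order_trans)
    then have "6 * a + 1 - y ^ 3 / 3 \<le> 0" by simp
    with \<kappa> have "2 * \<kappa> * (6 * a + 1 - y ^ 3 / 3) * (W y)\<^sup>2 \<le> 0"
      by (intro mult_nonpos_nonneg mult_nonneg_nonpos) auto
    then have "2 * \<kappa> * (6 * a + 1 - y ^ 3 / 3) * (W y)\<^sup>2 / y \<le> 0"
      using y1 by (intro divide_nonpos_nonneg) auto
    then show "\<exists>D. (E has_real_derivative D) (at y) \<and> D \<le> 0" using dE[of y] y1
      by (intro exI conjI) auto
  qed
  \<comment> \<open>The energy is used only beyond \<open>T\<close>; on the remaining compact
    interval continuity bounds \<open>V\<close>.\<close>
  have "compact (V ` {1..T})"
  proof (intro compact_continuous_image continuous_at_imp_continuous_on ballI)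
    fix x assume "x \<in> {1..T}"
    then show "isCont V x" by (intro DERIV_isCont[OF dV]) auto
  qed auto
  then have "bounded (V ` {1..T})" by (rule compact_imp_bounded)
  then obtain B where B: "\<forall>x\<in>{1..T}. \<bar>V x\<bar> \<le> B" by (auto simp: bounded_iff)
  have "\<bar>V x\<bar> \<le> max B (sqrt (E T))" if "x > 1" for x
  proof (cases "x \<le> T")
    case True
    then have "\<bar>V x\<bar> \<le> B" using B that by simp
    then show ?thesis by simp
  next
    case False
    have "(V x)\<^sup>2 \<le> E x" using \<kappa> by (simp add: E_def)
    also have "\<dots> \<le> E T" using False by (intro mono) auto
    finally have "\<bar>V x\<bar> \<le> sqrt (E T)" by (metis real_sqrt_abs real_sqrt_le_mono)
    then show ?thesis by simp
  qed
  moreover have "\<bar>kummerU a x\<bar> = \<bar>V x\<bar> * x powr (- 3 * a)" if "x > 1" for x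
    using that by (simp add: V_def u_def abs_mult powr_minus field_simps)
  ultimately show ?thesis by (auto intro!: exI[of _ "max B (sqrt (E T))"] mult_right_mono)
qed

section \<open>Symbol estimates\<close>

text \<open>\<open>symbol_class n p f\<close>: the first \<open>n\<close> iterates of \<open>x d/dx\<close> on \<open>f\<close> are \<open>O(x\<^sup>p)\<close> on \<open>x > 1\<close>.\<close>

primrec symbol_class :: "nat \<Rightarrow> real \<Rightarrow> (real \<Rightarrow> real) \<Rightarrow> bool" where
  "symbol_class 0 p f \<longleftrightarrow> (\<exists>C. \<forall>x>1. \<bar>f x\<bar> \<le> C * x powr p)"
| "symbol_class (Suc n) p f \<longleftrightarrow> (\<exists>C. \<forall>x>1. \<bar>f x\<bar> \<le> C * x powr p) \<and>
     (\<exists>g. (\<forall>x>1. (f has_real_derivative g x / x) (at x)) \<and> symbol_class n p g)"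

lemma symbol_class_bound:
  "symbol_class n p f \<Longrightarrow> \<exists>C. \<forall>x>1. \<bar>f x\<bar> \<le> C * x powr p"
  by (cases n) auto

lemma symbol_class_cong:
  assumes "symbol_class n p f" "\<And>x. x > 1 \<Longrightarrow> f x = g x"
  shows "symbol_class n p g"
proof (cases n)
  case 0
  then show ?thesis using assms by simp
next
  case (Suc m)
  with assms(1) obtain h where h: "\<forall>x>1. (f has_real_derivative h x / x) (at x)" "symbol_class m p h"
    by auto
  have "(g has_real_derivative h x / x) (at x)" if "x > 1" for x
    by (rule has_field_derivative_transform_within_open[of f _ _ "{1<..}"])
       (use h that assms(2) in auto)
  then show ?thesis using h symbol_class_bound[OF assms(1)] assms(2) unfolding Suc by auto
qed

lemma symbol_class_Suc_imp: "symbol_class (Suc n) p f \<Longrightarrow> symbol_class n p f"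
proof (induction n arbitrary: f)
  case (Suc n)
  then show ?case by (metis symbol_class.simps(2))
qed simp

lemma symbol_class_mono:
  assumes "symbol_class n p f" "p \<le> q"
  shows "symbol_class n q f"
proof -
  have *: "\<exists>C. \<forall>x>1. \<bar>f x\<bar> \<le> C * x powr q" if "\<exists>C. \<forall>x>1. \<bar>f x\<bar> \<le> C * x powr p" for f :: "real \<Rightarrow> real"
  proof -
    from that obtain C where C: "\<And>x. x > 1 \<Longrightarrow> \<bar>f x\<bar> \<le> C * x powr p" by auto
    have "\<bar>f x\<bar> \<le> \<bar>C\<bar> * x powr q" if x: "x > 1" for x
    proof -
      have "\<bar>f x\<bar> \<le> C * x powr p" by (rule C[OF x])
      also have "\<dots> \<le> \<bar>C\<bar> * x powr p" by (intro mult_right_mono) auto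
      also have "\<dots> \<le> \<bar>C\<bar> * x powr q" using assms(2) x by (intro mult_left_mono powr_mono) auto
      finally show ?thesis .
    qed
    then show ?thesis by blast
  qed
  from assms(1) show ?thesis
  proof (induction n arbitrary: f)
    case 0
    then show ?case using * by simp
  next
    case (Suc n)
    then obtain g where "\<forall>x>1. (f has_real_derivative g x / x) (at x)" "symbol_class n q g"
      by auto
    moreover have "\<exists>C. \<forall>x>1. \<bar>f x\<bar> \<le> C * x powr q"
      using Suc.prems by (intro *) auto
    ultimately show ?case unfolding symbol_class.simps by blast
  qed
qed

lemma symbol_class_add:
  assumes "symbol_class n p f" "symbol_class n p g"
  shows "symbol_class n p (\<lambda>x. f x + g x)"
proof -
  have *: "\<exists>C. \<forall>x>1. \<bar>f x + g x\<bar> \<le> C * x powr p"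
    if "\<exists>C. \<forall>x>1. \<bar>f x\<bar> \<le> C * x powr p" "\<exists>C. \<forall>x>1. \<bar>g x\<bar> \<le> C * x powr p" for f g :: "real \<Rightarrow> real"
  proof -
    from that obtain C D where C: "\<And>x. x > 1 \<Longrightarrow> \<bar>f x\<bar> \<le> C * x powr p"
      and D: "\<And>x. x > 1 \<Longrightarrow> \<bar>g x\<bar> \<le> D * x powr p" by auto
    have "\<bar>f x + g x\<bar> \<le> (C + D) * x powr p" if "x > 1" for x
      using C[OF that] D[OF that] by (simp add: distrib_right)
    then show ?thesis by blast
  qed
  from assms show ?thesis
  proof (induction n arbitrary: f g)
    case 0
    then show ?case using *[of f g] by simp
  next
    case (Suc n)
    obtain f' g' where d: "\<And>x. x > 1 \<Longrightarrow> (f has_real_derivative f' x / x) (at x)" "symbol_class n p f'"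
      "\<And>x. x > 1 \<Longrightarrow> (g has_real_derivative g' x / x) (at x)" "symbol_class n p g'"
      using Suc.prems by auto
    have "((\<lambda>x. f x + g x) has_real_derivative (f' x + g' x) / x) (at x)" if "x > 1" for x
      using DERIV_add[OF d(1)[OF that] d(3)[OF that]] by (simp add: add_divide_distrib)
    moreover have "symbol_class n p (\<lambda>x. f' x + g' x)" using Suc.IH d by blast
    moreover have "\<exists>C. \<forall>x>1. \<bar>f x + g x\<bar> \<le> C * x powr p"
      using Suc.prems by (intro *) (auto dest: symbol_class_bound)
    ultimately show ?case unfolding symbol_class.simps
      by (intro conjI exI[of _ "\<lambda>x. f' x + g' x"]) auto
  qed
qed

lemma symbol_class_mult:
  assumes "symbol_class n p f" "symbol_class n q g"
  shows "symbol_class n (p + q) (\<lambda>x. f x * g x)"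
proof -
  have *: "\<exists>C. \<forall>x>1. \<bar>f x * g x\<bar> \<le> C * x powr (p + q)"
    if "\<exists>C. \<forall>x>1. \<bar>f x\<bar> \<le> C * x powr p" "\<exists>C. \<forall>x>1. \<bar>g x\<bar> \<le> C * x powr q" for f g :: "real \<Rightarrow> real"
  proof -
    from that obtain C D where C: "\<And>x. x > 1 \<Longrightarrow> \<bar>f x\<bar> \<le> C * x powr p"
      and D: "\<And>x. x > 1 \<Longrightarrow> \<bar>g x\<bar> \<le> D * x powr q" by auto
    have "\<bar>f x * g x\<bar> \<le> C * D * x powr (p + q)" if "x > 1" for x
    proof -
      have "\<bar>f x * g x\<bar> \<le> (C * x powr p) * (D * x powr q)"
        unfolding abs_mult using C[OF that] D[OF that] by (intro mult_mono) (auto intro: order_trans[OF abs_ge_zero])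
      then show ?thesis by (simp add: powr_add mult_ac)
    qed
    then show ?thesis by blast
  qed
  from assms show ?thesis
  proof (induction n arbitrary: f g)
    case 0
    then show ?case using *[of f g] by simp
  next
    case (Suc n)
    obtain f' g' where d: "\<And>x. x > 1 \<Longrightarrow> (f has_real_derivative f' x / x) (at x)" "symbol_class n p f'"
      "\<And>x. x > 1 \<Longrightarrow> (g has_real_derivative g' x / x) (at x)" "symbol_class n q g'"
      using Suc.prems by auto
    have "((\<lambda>x. f x * g x) has_real_derivative (f' x * g x + f x * g' x) / x) (at x)" if "x > 1" for x
      using DERIV_mult[OF d(1)[OF that] d(3)[OF that]] by (simp add: add_divide_distrib mult.commute)
    moreover have "symbol_class n (p + q) (\<lambda>x. f' x * g x + f x * g' x)"
      using Suc.IH d Suc.prems by (intro symbol_class_add) (blast intro: symbol_class_Suc_imp)+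
    moreover have "\<exists>C. \<forall>x>1. \<bar>f x * g x\<bar> \<le> C * x powr (p + q)"
      using Suc.prems by (intro *) (auto dest: symbol_class_bound)
    ultimately show ?case unfolding symbol_class.simps
      by (intro conjI exI[of _ "\<lambda>x. f' x * g x + f x * g' x"]) auto
  qed
qed

lemma symbol_class_const: "symbol_class n 0 (\<lambda>_. c)"
proof (induction n arbitrary: c)
  case 0
  then show ?case by (auto intro!: exI[of _ "\<bar>c\<bar>"])
next
  case (Suc n)
  then show ?case by (auto intro!: exI[of _ "\<bar>c\<bar>"] exI[of _ "\<lambda>_. 0"])
qed

lemma symbol_class_cmult:
  "symbol_class n p f \<Longrightarrow> symbol_class n p (\<lambda>x. c * f x)"
  using symbol_class_mult[OF symbol_class_const[of n c], of p f] by simp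

lemma symbol_class_powr: "symbol_class n r (\<lambda>x. x powr r)"
proof (induction n)
  case 0
  then show ?case by (auto intro!: exI[of _ 1])
next
  case (Suc n)
  have "((\<lambda>x. x powr r) has_real_derivative (r * x powr r) / x) (at x)" if "x > 1" for x
    using has_real_derivative_powr[of x r] that by (simp add: powr_diff)
  moreover have "symbol_class n r (\<lambda>x. r * x powr r)" by (rule symbol_class_cmult) (rule Suc)
  ultimately show ?case unfolding symbol_class.simps
    by (intro conjI exI[of _ "\<lambda>x. r * x powr r"]) (auto intro!: exI[of _ 1])
qed

lemma has_real_derivative_one_plus_square_powr:
  "((\<lambda>x::real. (1 + x\<^sup>2) powr c) has_real_derivative 2 * c * (x * (1 + x\<^sup>2) powr (c - 1))) (at x)"
proof -
  have "((\<lambda>x. 1 + x\<^sup>2) has_real_derivative 2 * x) (at x)" by (auto intro!: derivative_eq_intros)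
  moreover have "1 + x\<^sup>2 > 0" by (simp add: add_pos_nonneg)
  ultimately show ?thesis using DERIV_fun_powr[of "\<lambda>x. 1 + x\<^sup>2" "2 * x" x c] by (simp add: mult_ac)
qed

text \<open>The Euler derivative is \<open>2 * c * (x^2 * (1 + x^2) powr (c - 1))\<close>, again of
  order \<open>2 + 2 * (c - 1) = 2 * c\<close>; hence the induction with \<open>c\<close>
  arbitrary.\<close>

lemma symbol_class_one_plus_square_powr: "symbol_class n (2 * c) (\<lambda>x. (1 + x\<^sup>2) powr c)"
proof (induction n arbitrary: c)
  have *: "\<exists>C. \<forall>x>1. \<bar>(1 + x\<^sup>2) powr c\<bar> \<le> C * x powr (2 * c)" for c :: real
  proof (intro exI allI impI)
    fix x :: real assume x: "x > 1"
    have x2: "x powr (2 * c) = (x\<^sup>2) powr c"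
      using x by (simp add: powr_powr flip: powr_numeral)
    \<comment> \<open>For \<open>c \<ge> 0\<close> use \<open>1 + x^2 \<le> 2 * x^2\<close>, for
      negative \<open>c\<close> use \<open>1 + x^2 \<ge> x^2\<close>; the maximum serves
      both.\<close>
    show "\<bar>(1 + x\<^sup>2) powr c\<bar> \<le> max 1 (2 powr c) * x powr (2 * c)"
    proof (cases "c \<ge> 0")
      case True
      have "(1 + x\<^sup>2) powr c \<le> (2 * x\<^sup>2) powr c"
        using True x by (intro powr_mono2) (auto simp: one_le_power)
      also have "\<dots> = 2 powr c * (x\<^sup>2) powr c" by (simp add: powr_mult)
      also have "\<dots> \<le> max 1 (2 powr c) * (x\<^sup>2) powr c" by (intro mult_right_mono) auto
      finally show ?thesis unfolding x2 by simp
    next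
      case False
      have "(1 + x\<^sup>2) powr c \<le> (x\<^sup>2) powr c"
        using False x by (intro powr_mono2') auto
      also have "\<dots> = 1 * (x\<^sup>2) powr c" by simp
      also have "\<dots> \<le> max 1 (2 powr c) * (x\<^sup>2) powr c" by (intro mult_right_mono) auto
      finally show ?thesis unfolding x2 by simp
    qed
  qed
  {
    case 0
    show ?case using *[of c] by simp
  next
    case (Suc n)
    have "((\<lambda>x. (1 + x\<^sup>2) powr c) has_real_derivative (2 * c * (x powr 2 * (1 + x\<^sup>2) powr (c - 1))) / x) (at x)"
      if "x > 1" for x
      by (rule DERIV_cong[OF has_real_derivative_one_plus_square_powr])
         (use that in \<open>simp add: power2_eq_square\<close>)
    moreover have "symbol_class n (2 * c) (\<lambda>x. 2 * c * (x powr 2 * (1 + x\<^sup>2) powr (c - 1)))"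
      using symbol_class_mult[OF symbol_class_powr[of n 2] Suc[of "c - 1"]]
      by (intro symbol_class_cmult) (simp add: algebra_simps)
    ultimately show ?case using *[of c] unfolding symbol_class.simps
      by (intro conjI exI[of _ "\<lambda>x. 2 * c * (x powr 2 * (1 + x\<^sup>2) powr (c - 1))"]) auto
  }
qed

section \<open>Euler derivatives of \<open>kummerU\<close> at both ends\<close>

text \<open>\<open>kummerU_raise\<close> solved for the Euler derivative. This operator commutes
  with scaling by \<sigma>, so one formula serves both ends of the line.\<close>

lemma kummerU_euler_derivative:
  assumes "a \<notin> \<int>\<^sub>\<le>\<^sub>0" "a + 1/3 \<notin> \<int>\<^sub>\<le>\<^sub>0" "x > 0"
  shows "((\<lambda>x. kummerU a (\<sigma> * x)) has_real_derivative
    (3 * (a * (a + 1/3)) * kummerU (a + 1) (\<sigma> * x) + - 3 * a * kummerU a (\<sigma> * x)) / x) (at x)"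
proof -
  have "((\<lambda>x. \<sigma> * x) has_real_derivative \<sigma>) (at x)" by (auto intro!: derivative_eq_intros)
  from DERIV_chain2[OF has_real_derivative_kummerU this]
  have "((\<lambda>x. kummerU a (\<sigma> * x)) has_real_derivative kummerU' a (\<sigma> * x) * \<sigma>) (at x)" .
  moreover have "3 * (a * (a + 1/3)) * kummerU (a + 1) (\<sigma> * x) + - 3 * a * kummerU a (\<sigma> * x)
      = x * (kummerU' a (\<sigma> * x) * \<sigma>)"
  proof -
    have "x * (kummerU' a (\<sigma> * x) * \<sigma>) = 3 * (\<sigma> * x * kummerU' a (\<sigma> * x) / 3)" by simp
    also have "\<sigma> * x * kummerU' a (\<sigma> * x) / 3 = a * (a + 1/3) * kummerU (a + 1) (\<sigma> * x) - a * kummerU a (\<sigma> * x)"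
      using kummerU_raise[OF assms(1,2), of "\<sigma> * x"] by linarith
    finally show ?thesis by (simp add: right_diff_distrib mult.assoc)
  qed
  ultimately show ?thesis using assms(3) by simp
qed

text \<open>The Euler derivative stays in the span of \<open>kummerU a\<close> and
  \<open>kummerU (a + 1)\<close>, the latter of even smaller order. Each derivative raises
  \<open>a\<close>, so positivity persists and the two end bounds remain available.\<close>

lemma symbol_class_kummerU_pos:
  assumes "a > 0" "\<sigma> = 1 \<or> \<sigma> = -1"
  shows "symbol_class n (- 3 * a) (\<lambda>x. kummerU a (\<sigma> * x))"
  using assms(1)
proof (induction n arbitrary: a)
  case 0
  from assms(2) have "\<exists>C. \<forall>x>1. \<bar>kummerU a (\<sigma> * x)\<bar> \<le> C * x powr (- 3 * a)"
    by (elim disjE; use kummerU_bound_at_top[OF 0] kummerU_bound_at_bot[OF 0] in simp)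
  then show ?case by simp
next
  case (Suc n)
  have a': "a \<notin> \<int>\<^sub>\<le>\<^sub>0" "a + 1/3 \<notin> \<int>\<^sub>\<le>\<^sub>0" using Suc.prems by (auto intro!: not_nonpos_Ints_of_pos)
  from assms(2) have bd: "\<exists>C. \<forall>x>1. \<bar>kummerU a (\<sigma> * x)\<bar> \<le> C * x powr (- 3 * a)"
    by (elim disjE; use kummerU_bound_at_top[OF Suc.prems] kummerU_bound_at_bot[OF Suc.prems] in simp)
  have "symbol_class n (- 3 * (a + 1)) (\<lambda>x. kummerU (a + 1) (\<sigma> * x))"
    by (intro Suc.IH) (use Suc.prems in simp)
  then have "symbol_class n (- 3 * a) (\<lambda>x. kummerU (a + 1) (\<sigma> * x))"
    by (rule symbol_class_mono) simp
  then have "symbol_class n (- 3 * a) (\<lambda>x. 3 * (a * (a + 1/3)) * kummerU (a + 1) (\<sigma> * x) + - 3 * a * kummerU a (\<sigma> * x))"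
    by (intro symbol_class_add symbol_class_cmult Suc)
  then show ?case using bd kummerU_euler_derivative[OF a', of _ \<sigma>] unfolding symbol_class.simps
    by (intro conjI exI[of _ "\<lambda>x. 3 * (a * (a + 1/3)) * kummerU (a + 1) (\<sigma> * x) + - 3 * a * kummerU a (\<sigma> * x)"]) auto
qed

text \<open>Descent from positive \<open>a\<close> in unit steps by \<open>kummerU_lower\<close>.
  Its worst term, \<open>t^3\<close> times \<open>kummerU (a + 1)\<close>, has order
  \<open>3 - 3 * (a + 1) = - 3 * a\<close>, so the step loses nothing.\<close>

lemma symbol_class_kummerU:
  assumes "a \<notin> \<int>\<^sub>\<le>\<^sub>0" "a + 1/3 \<notin> \<int>\<^sub>\<le>\<^sub>0" and \<sigma>: "\<sigma> = 1 \<or> \<sigma> = -1"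
  shows "symbol_class n (- 3 * a) (\<lambda>x. kummerU a (\<sigma> * x))"
proof -
  obtain m :: nat where "a > - real m" using reals_Archimedean2[of "- a"] by (auto simp: minus_less_iff)
  then show ?thesis using assms(1,2)
  proof (induction m arbitrary: a n)
    case 0
    then show ?case using symbol_class_kummerU_pos \<sigma> by simp
  next
    case (Suc m)
    have "a + 1 \<notin> \<int>\<^sub>\<le>\<^sub>0" "a + 1 + 1/3 \<notin> \<int>\<^sub>\<le>\<^sub>0"
      using Suc.prems plus_one_in_nonpos_Ints_imp[of a] plus_one_in_nonpos_Ints_imp[of "a + 1/3"]
      by (auto simp: add_ac)
    then have IH: "symbol_class n (- 3 * (a + 1)) (\<lambda>x. kummerU (a + 1) (\<sigma> * x))" for n
      using Suc.prems by (intro Suc.IH) auto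
    obtain g where g: "\<And>x. x > 1 \<Longrightarrow> ((\<lambda>x. kummerU (a + 1) (\<sigma> * x)) has_real_derivative g x / x) (at x)"
      "symbol_class n (- 3 * (a + 1)) g"
      \<comment> \<open>One order more than \<open>n\<close>, because \<open>kummerU_lower\<close>
        itself contains a derivative.\<close>
      using IH[of "Suc n"] by auto
    \<comment> \<open>The class provides \<open>g\<close> only existentially; uniqueness of
      derivatives identifies it.\<close>
    have g_eq: "g x = \<sigma> * x * kummerU' (a + 1) (\<sigma> * x)" if x: "x > 1" for x
    proof -
      have "((\<lambda>x. \<sigma> * x) has_real_derivative \<sigma>) (at x)" by (auto intro!: derivative_eq_intros)
      from DERIV_unique[OF g(1)[OF x] DERIV_chain2[OF has_real_derivative_kummerU this]]
      show ?thesis using x by (simp add: field_simps)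
    qed
    let ?h = "\<lambda>x. (a + 1/3) * kummerU (a + 1) (\<sigma> * x)
        + (- \<sigma> / 9 * (x powr 3 * kummerU (a + 1) (\<sigma> * x)) + - 1 / 3 * g x)"
    have "symbol_class n (- 3 * a) ?h"
    proof (intro symbol_class_add symbol_class_cmult)
      show "symbol_class n (- 3 * a) (\<lambda>x. kummerU (a + 1) (\<sigma> * x))" "symbol_class n (- 3 * a) g"
        using symbol_class_mono[OF IH] symbol_class_mono[OF g(2)] by auto
      show "symbol_class n (- 3 * a) (\<lambda>x. x powr 3 * kummerU (a + 1) (\<sigma> * x))"
        using symbol_class_mult[OF symbol_class_powr[of n 3] IH[of n]] by simp
    qed
    then show ?case
    proof (rule symbol_class_cong)
      fix x :: real assume x: "x > 1"
      have "(\<sigma> * x) ^ 3 = \<sigma> * x powr 3" using \<sigma> x by (auto simp: powr_numeral)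
      then show "?h x = kummerU a (\<sigma> * x)"
        using kummerU_lower[OF Suc.prems(2,3), of "\<sigma> * x"] g_eq[OF x] by simp
    qed
  qed
qed

section \<open>Smoothness on the whole line\<close>

text \<open>The existential form hands over the successive derivatives as functions, the last one
  continuous; this settles the compact middle range.\<close>

primrec Ck :: "nat \<Rightarrow> (real \<Rightarrow> real) \<Rightarrow> bool" where
  "Ck 0 f \<longleftrightarrow> continuous_on UNIV f"
| "Ck (Suc n) f \<longleftrightarrow> (\<exists>g. (\<forall>t. (f has_real_derivative g t) (at t)) \<and> Ck n g)"

lemma Ck_Suc_imp: "Ck (Suc n) f \<Longrightarrow> Ck n f"
proof (induction n arbitrary: f)
  case 0
  then show ?case by (auto intro!: continuous_at_imp_continuous_on intro: DERIV_isCont)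
next
  case (Suc n)
  then show ?case by (metis Ck.simps(2))
qed

lemma Ck_const: "Ck n (\<lambda>_. c)"
  by (induction n arbitrary: c) (auto intro!: exI[of _ "\<lambda>_. 0"])

lemma Ck_id: "Ck n (\<lambda>t. t)"
  by (cases n) (auto intro!: exI[of _ "\<lambda>_. 1"] Ck_const)

lemma Ck_add: "Ck n f \<Longrightarrow> Ck n g \<Longrightarrow> Ck n (\<lambda>t. f t + g t)"
proof (induction n arbitrary: f g)
  case 0
  then show ?case by (auto intro!: continuous_intros)
next
  case (Suc n)
  then obtain f' g' where "\<And>t. (f has_real_derivative f' t) (at t)" "Ck n f'"
    "\<And>t. (g has_real_derivative g' t) (at t)" "Ck n g'" by auto
  then show ?case using Suc.IH[of f' g'] by (auto intro!: exI[of _ "\<lambda>t. f' t + g' t"] DERIV_add)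
qed

lemma Ck_mult: "Ck n f \<Longrightarrow> Ck n g \<Longrightarrow> Ck n (\<lambda>t. f t * g t)"
proof (induction n arbitrary: f g)
  case 0
  then show ?case by (auto intro!: continuous_intros)
next
  case (Suc n)
  then obtain f' g' where d: "\<And>t. (f has_real_derivative f' t) (at t)" "Ck n f'"
    "\<And>t. (g has_real_derivative g' t) (at t)" "Ck n g'" by auto
  have "Ck n (\<lambda>t. f' t * g t + g' t * f t)"
    by (intro Ck_add Suc.IH d Ck_Suc_imp[OF Suc.prems(1)] Ck_Suc_imp[OF Suc.prems(2)])
  moreover have "((\<lambda>t. f t * g t) has_real_derivative f' t * g t + g' t * f t) (at t)" for t
    by (rule DERIV_mult d)+
  ultimately show ?case unfolding Ck.simps
    by (intro exI[of _ "\<lambda>t. f' t * g t + g' t * f t"]) auto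
qed

lemma Ck_one_plus_square_powr: "Ck n (\<lambda>t. (1 + t\<^sup>2) powr c)"
proof (induction n arbitrary: c)
  case 0
  then show ?case
    by (auto intro!: continuous_at_imp_continuous_on DERIV_isCont[OF has_real_derivative_one_plus_square_powr])
next
  case (Suc n)
  have "Ck n (\<lambda>t. 2 * c * (t * (1 + t\<^sup>2) powr (c - 1)))"
    by (intro Ck_mult[OF Ck_const] Ck_mult[OF Ck_id] Suc)
  then show ?case unfolding Ck.simps
    by (intro exI[of _ "\<lambda>t. 2 * c * (t * (1 + t\<^sup>2) powr (c - 1))"])
      (auto intro: has_real_derivative_one_plus_square_powr)
qed

lemma Ck_kummerM_cube: "b > 0 \<Longrightarrow> Ck n (\<lambda>t. kummerM a b (-(t^3) / 9))"
proof (induction n arbitrary: a b)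
  case 0
  then show ?case unfolding Ck.simps
    by (intro continuous_at_imp_continuous_on ballI DERIV_isCont[OF has_real_derivative_kummerM_cube])
next
  case (Suc n)
  have "Ck n (\<lambda>t. (- (a / b) / 3) * ((t * t) * kummerM (a + 1) (b + 1) (-(t^3) / 9)))"
    using Suc.prems by (intro Ck_mult[OF Ck_const] Ck_mult[OF Ck_mult[OF Ck_id Ck_id]] Suc.IH) auto
  moreover have "((\<lambda>t. kummerM a b (-(t^3) / 9)) has_real_derivative
     (- (a / b) / 3) * ((t * t) * kummerM (a + 1) (b + 1) (-(t^3) / 9))) (at t)" for t
    by (rule DERIV_cong[OF has_real_derivative_kummerM_cube[OF Suc.prems]]) (simp add: power2_eq_square mult_ac)
  ultimately show ?case unfolding Ck.simps
    by (intro exI[of _ "\<lambda>t. (- (a / b) / 3) * ((t * t) * kummerM (a + 1) (b + 1) (-(t^3) / 9))"]) blast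
qed

lemma Ck_kummerU: "Ck n (kummerU a)"
proof -
  have "Ck n (\<lambda>t. Gamma (1/3) / Gamma (a + 1/3) * kummerM a (2/3) (-(t^3) / 9)
     + (- (1 / 9 powr (1/3) * (Gamma (-1/3) / Gamma a))) * (t * kummerM (a + 1/3) (4/3) (-(t^3) / 9)))"
    by (intro Ck_add Ck_mult[OF Ck_const] Ck_mult[OF Ck_id] Ck_kummerM_cube) auto
  also have "(\<lambda>t. Gamma (1/3) / Gamma (a + 1/3) * kummerM a (2/3) (-(t^3) / 9)
     + (- (1 / 9 powr (1/3) * (Gamma (-1/3) / Gamma a))) * (t * kummerM (a + 1/3) (4/3) (-(t^3) / 9))) = kummerU a"
    by (rule ext) (simp add: kummerU_def)
  finally show ?thesis .
qed

section \<open>Derivative bounds for \<open>Lambda\<close>\<close>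

text \<open>With \<open>h\<close> and \<open>l\<close> the first and second Euler derivatives of
  \<open>g\<close>, the derivatives of \<open>f\<close> at \<open>\<sigma> * x\<close> are
  \<open>\<sigma> * g / x\<close>, \<open>(h - g) / x^2\<close> and
  \<open>\<sigma> * (l - 3 * h + 2 * g) / x^3\<close>. Each weight leaves a factor
  \<open>x^2\<close>, which the order -2 cancels.\<close>

lemma derivative_bounds_of_symbol_class:
  fixes f f1 f2 f3 g :: "real \<Rightarrow> real"
  assumes f1: "\<And>t. (f has_real_derivative f1 t) (at t)"
    and f2: "\<And>t. (f1 has_real_derivative f2 t) (at t)"
    and f3: "\<And>t. (f2 has_real_derivative f3 t) (at t)"
    and \<sigma>: "\<sigma> = 1 \<or> \<sigma> = -1"
    and g: "\<And>x. x > 1 \<Longrightarrow> ((\<lambda>x. f (\<sigma> * x)) has_real_derivative g x / x) (at x)"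
      "symbol_class 2 (- 2) g"
  shows "\<exists>C. \<forall>x>1. \<bar>x ^ 3 * f1 (\<sigma> * x)\<bar> + \<bar>x ^ 4 * f2 (\<sigma> * x)\<bar> + \<bar>x ^ 5 * f3 (\<sigma> * x)\<bar> \<le> C"
proof -
  have \<sigma>\<sigma>: "\<sigma> * \<sigma> = 1" "\<bar>\<sigma>\<bar> = 1" using \<sigma> by auto
  obtain h l where h: "\<And>x. x > 1 \<Longrightarrow> (g has_real_derivative h x / x) (at x)" "symbol_class 1 (-2) h"
    and l: "\<And>x. x > 1 \<Longrightarrow> (h has_real_derivative l x / x) (at x)" "symbol_class 0 (-2) l"
    using g(2) by (auto simp: numeral_2_eq_2)
  obtain A where A: "\<And>x. x > 1 \<Longrightarrow> \<bar>g x\<bar> \<le> A * x powr (-2)"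
    using symbol_class_bound[OF g(2)] by blast
  obtain B where B: "\<And>x. x > 1 \<Longrightarrow> \<bar>h x\<bar> \<le> B * x powr (-2)"
    using symbol_class_bound[OF h(2)] by blast
  obtain C where C: "\<And>x. x > 1 \<Longrightarrow> \<bar>l x\<bar> \<le> C * x powr (-2)"
    using symbol_class_bound[OF l(2)] by blast
  have chain: "((\<lambda>x. F (\<sigma> * x)) has_real_derivative F' (\<sigma> * x) * \<sigma>) (at x)"
    if "\<And>t. (F has_real_derivative F' t) (at t)" for F F' x
  proof -
    have "((\<lambda>x. \<sigma> * x) has_real_derivative \<sigma>) (at x)" by (auto intro!: derivative_eq_intros)
    from DERIV_chain2[OF that this] show ?thesis .
  qed
  \<comment> \<open>The chain rule produces a factor \<sigma>, which is its own inverse and so moves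
    to the other side.\<close>
  have unique: "F' (\<sigma> * x) = \<sigma> * D"
    if "\<And>t. (F has_real_derivative F' t) (at t)" "(G has_real_derivative D) (at x)"
      "\<And>x. x > 1 \<Longrightarrow> F (\<sigma> * x) = G x" "x > 1" for F F' G D x
  proof -
    have "((\<lambda>x. F (\<sigma> * x)) has_real_derivative D) (at x)"
      by (rule has_field_derivative_transform_within_open[of G _ _ "{1<..}"]) (use that in auto)
    from DERIV_unique[OF chain[OF that(1)] this] have "\<sigma> * D = \<sigma> * \<sigma> * F' (\<sigma> * x)"
      by (simp add: mult_ac)
    then show ?thesis using \<sigma>\<sigma> by simp
  qed
  have e1: "f1 (\<sigma> * x) = \<sigma> * (g x / x)" if "x > 1" for x
    by (rule unique[OF f1 g(1)]) (use that in auto)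
  have e2: "f2 (\<sigma> * x) = (h x - g x) / x ^ 2" if x: "x > 1" for x
  proof -
    have "((\<lambda>x. \<sigma> * (g x / x)) has_real_derivative \<sigma> * ((h x / x * x - g x * 1) / (x * x))) (at x)"
      by (intro DERIV_cmult DERIV_divide h DERIV_ident) (use x in auto)
    from unique[OF f2 this e1 x] have "f2 (\<sigma> * x) = (\<sigma> * \<sigma>) * ((h x / x * x - g x * 1) / (x * x))" by simp
    then show ?thesis using x by (simp add: \<sigma>\<sigma> power2_eq_square)
  qed
  have e3: "f3 (\<sigma> * x) = \<sigma> * ((l x - 3 * h x + 2 * g x) / x ^ 3)" if x: "x > 1" for x
  proof -
    have "((\<lambda>x. x ^ 2) has_real_derivative 2 * x) (at x)" by (auto intro!: derivative_eq_intros)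
    then have "((\<lambda>x. (h x - g x) / x ^ 2) has_real_derivative
        ((l x / x - h x / x) * x ^ 2 - (h x - g x) * (2 * x)) / (x ^ 2 * x ^ 2)) (at x)"
      by (intro DERIV_divide DERIV_diff h l) (use x in auto)
    from unique[OF f3 this e2 x] have "f3 (\<sigma> * x) =
        \<sigma> * (((l x / x - h x / x) * x ^ 2 - (h x - g x) * (2 * x)) / (x ^ 2 * x ^ 2))" .
    also have "((l x / x - h x / x) * x ^ 2 - (h x - g x) * (2 * x)) / (x ^ 2 * x ^ 2)
        = (x * (l x - 3 * h x + 2 * g x)) / (x * x ^ 3)"
    proof -
      have "(l x / x - h x / x) * x ^ 2 = (l x - h x) * x" using x by (simp add: power2_eq_square field_simps)
      moreover have "x ^ 2 * x ^ 2 = x * x ^ 3" by (simp add: eval_nat_numeral)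
      ultimately show ?thesis by (simp add: algebra_simps)
    qed
    also have "\<dots> = (l x - 3 * h x + 2 * g x) / x ^ 3" using x by simp
    finally show ?thesis .
  qed
  have "\<bar>x ^ 3 * f1 (\<sigma> * x)\<bar> + \<bar>x ^ 4 * f2 (\<sigma> * x)\<bar> + \<bar>x ^ 5 * f3 (\<sigma> * x)\<bar> \<le> A + (B + A) + (C + 3 * B + 2 * A)"
    if x: "x > 1" for x
  proof -
    have P: "x powr (-2) * x\<^sup>2 = 1" using x by (simp add: powr_minus powr_numeral)
    have "\<bar>g x\<bar> * x\<^sup>2 \<le> A * x powr (-2) * x\<^sup>2" by (intro mult_right_mono A x) auto
    then have a: "\<bar>g x\<bar> * x\<^sup>2 \<le> A" by (simp add: mult.assoc P)
    have "\<bar>h x\<bar> * x\<^sup>2 \<le> B * x powr (-2) * x\<^sup>2" by (intro mult_right_mono B x) auto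
    then have b: "\<bar>h x\<bar> * x\<^sup>2 \<le> B" by (simp add: mult.assoc P)
    have "\<bar>l x\<bar> * x\<^sup>2 \<le> C * x powr (-2) * x\<^sup>2" by (intro mult_right_mono C x) auto
    then have c: "\<bar>l x\<bar> * x\<^sup>2 \<le> C" by (simp add: mult.assoc P)
    have "x ^ 3 * f1 (\<sigma> * x) = \<sigma> * (g x * x\<^sup>2)"
      unfolding e1[OF x] using x by (simp add: eval_nat_numeral)
    then have 1: "\<bar>x ^ 3 * f1 (\<sigma> * x)\<bar> = \<bar>g x\<bar> * x\<^sup>2" by (simp add: abs_mult \<sigma>\<sigma>)
    have "x ^ 4 * f2 (\<sigma> * x) = (h x - g x) * x\<^sup>2"
      unfolding e2[OF x] using x by (simp add: eval_nat_numeral)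
    then have "\<bar>x ^ 4 * f2 (\<sigma> * x)\<bar> = \<bar>h x - g x\<bar> * x\<^sup>2" by (simp add: abs_mult)
    also have "\<dots> \<le> (\<bar>h x\<bar> + \<bar>g x\<bar>) * x\<^sup>2" by (intro mult_right_mono) auto
    finally have 2: "\<bar>x ^ 4 * f2 (\<sigma> * x)\<bar> \<le> \<bar>h x\<bar> * x\<^sup>2 + \<bar>g x\<bar> * x\<^sup>2" by (simp add: distrib_right)
    have "x ^ 5 * f3 (\<sigma> * x) = \<sigma> * ((l x - 3 * h x + 2 * g x) * x\<^sup>2)"
      unfolding e3[OF x] using x by (simp add: eval_nat_numeral)
    then have "\<bar>x ^ 5 * f3 (\<sigma> * x)\<bar> = \<bar>l x - 3 * h x + 2 * g x\<bar> * x\<^sup>2" by (simp add: abs_mult \<sigma>\<sigma>)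
    also have "\<dots> \<le> (\<bar>l x\<bar> + 3 * \<bar>h x\<bar> + 2 * \<bar>g x\<bar>) * x\<^sup>2" by (intro mult_right_mono) auto
    finally have 3: "\<bar>x ^ 5 * f3 (\<sigma> * x)\<bar> \<le> \<bar>l x\<bar> * x\<^sup>2 + 3 * (\<bar>h x\<bar> * x\<^sup>2) + 2 * (\<bar>g x\<bar> * x\<^sup>2)"
      by (simp add: distrib_right)
    show ?thesis using 1 2 3 a b c by linarith
  qed
  then show ?thesis by blast
qed

lemma Lambda_eq_kummerU:
  "Lambda k = (\<lambda>t. 9 powr (1/6 + real_of_int k) *
     ((1 + t\<^sup>2) powr (3 * (-1/6 - real_of_int k) / 2) * kummerU (-1/6 - real_of_int k) t))"
proof -
  have "-1/4 - 3 * real_of_int k / 2 = 3 * (-1/6 - real_of_int k) / 2"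
    "1/6 - real_of_int k = -1/6 - real_of_int k + 1/3" by (simp_all add: field_simps)
  then show ?thesis unfolding Lambda_def[abs_def] kummerU_def by (simp only: mult.assoc)
qed

text \<open>Ensures that \<open>a = (-1 - 6 * k) / 6\<close> and
  \<open>a + 1/3 = (1 - 6 * k) / 6\<close> avoid the poles of Gamma.\<close>

lemma of_int_sixth_not_Int:
  fixes m :: int
  assumes "\<not> 6 dvd m"
  shows "real_of_int m / 6 \<notin> \<int>\<^sub>\<le>\<^sub>0"
proof
  assume "real_of_int m / 6 \<in> \<int>\<^sub>\<le>\<^sub>0"
  then obtain n where "real_of_int m / 6 = of_int n" by (auto elim!: nonpos_Ints_cases)
  then have "real_of_int m = real_of_int (6 * n)" by simp
  then have "m = 6 * n" by (simp only: of_int_eq_iff)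
  then show False using assms by simp
qed

theorem lemma2p15:
  fixes k :: int
  shows "\<exists>C>0. \<forall>t::real.
     \<bar>Lambda k t\<bar> + \<bar>t^3 * deriv (Lambda k) t\<bar> + \<bar>t^4 * (deriv ^^ 2) (Lambda k) t\<bar>
       + \<bar>t^5 * (deriv ^^ 3) (Lambda k) t\<bar> \<le> C"
proof -
  define a where "a = -1/6 - real_of_int k"
  define c where "c = (9::real) powr (1/6 + real_of_int k)"
  have L: "Lambda k = (\<lambda>t. c * ((1 + t\<^sup>2) powr (3 * a / 2) * kummerU a t))"
    unfolding Lambda_eq_kummerU a_def c_def ..
  have a': "a \<notin> \<int>\<^sub>\<le>\<^sub>0" "a + 1/3 \<notin> \<int>\<^sub>\<le>\<^sub>0"
  proof -
    have "a = real_of_int (-1 - 6 * k) / 6" "a + 1/3 = real_of_int (1 - 6 * k) / 6"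
      by (simp_all add: a_def field_simps)
    moreover have "\<not> 6 dvd (-1 - 6 * k)" "\<not> 6 dvd (1 - 6 * k)" by presburger+
    ultimately show "a \<notin> \<int>\<^sub>\<le>\<^sub>0" "a + 1/3 \<notin> \<int>\<^sub>\<le>\<^sub>0" using of_int_sixth_not_Int by metis+
  qed
  have a'': "a + 1 \<notin> \<int>\<^sub>\<le>\<^sub>0" "a + 1 + 1/3 \<notin> \<int>\<^sub>\<le>\<^sub>0"
    using a' plus_one_in_nonpos_Ints_imp[of a] plus_one_in_nonpos_Ints_imp[of "a + 1/3"]
    by (auto simp: add_ac)
  have "Ck 3 (Lambda k)" unfolding L
    by (intro Ck_mult[OF Ck_const] Ck_mult[OF Ck_one_plus_square_powr] Ck_kummerU)
  then obtain f1 f2 f3 where f1: "\<And>t. (Lambda k has_real_derivative f1 t) (at t)"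
    and f2: "\<And>t. (f1 has_real_derivative f2 t) (at t)"
    and f3: "\<And>t. (f2 has_real_derivative f3 t) (at t)" and cont: "continuous_on UNIV f3"
    by (auto simp: numeral_3_eq_3)
  have d1: "deriv (Lambda k) = f1" and d2: "deriv f1 = f2" and d3: "deriv f2 = f3"
    using f1 f2 f3 by (auto intro!: DERIV_imp_deriv ext)
  have dd: "(deriv ^^ 2) (Lambda k) = f2" "(deriv ^^ 3) (Lambda k) = f3"
    by (simp_all add: eval_nat_numeral d1 d2 d3)
  have bounds: "\<exists>C. \<forall>x>1. \<bar>Lambda k (\<sigma> * x)\<bar> + (\<bar>x ^ 3 * f1 (\<sigma> * x)\<bar> + \<bar>x ^ 4 * f2 (\<sigma> * x)\<bar> + \<bar>x ^ 5 * f3 (\<sigma> * x)\<bar>) \<le> C"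
    if \<sigma>: "\<sigma> = 1 \<or> \<sigma> = -1" for \<sigma>
  proof -
    have \<sigma>2: "(\<sigma> * x)\<^sup>2 = x\<^sup>2" for x using \<sigma> by auto
    have U: "symbol_class n (- 3 * a) (\<lambda>x. kummerU a (\<sigma> * x))" for n
      by (rule symbol_class_kummerU[OF a' \<sigma>])
    have U1: "symbol_class n (- 3 * (a + 1)) (\<lambda>x. kummerU (a + 1) (\<sigma> * x))" for n
      by (rule symbol_class_kummerU[OF a'' \<sigma>])
    \<comment> \<open>The orders \<open>3 * a\<close> and \<open>- 3 * a\<close> cancel, and order 0
      means boundedness.\<close>
    have "symbol_class 0 (2 * (3 * a / 2) + - 3 * a) (\<lambda>x. (1 + x\<^sup>2) powr (3 * a / 2) * kummerU a (\<sigma> * x))"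
      by (intro symbol_class_mult symbol_class_one_plus_square_powr U)
    then have "symbol_class 0 0 (\<lambda>x. Lambda k (\<sigma> * x))"
      unfolding L \<sigma>2 by (intro symbol_class_cmult) simp
    then obtain A where A: "\<And>x. x > 1 \<Longrightarrow> \<bar>Lambda k (\<sigma> * x)\<bar> \<le> A" by auto
    \<comment> \<open>The Euler derivative of \<open>Lambda k\<close>. With
      \<open>P = (1 + x^2) powr (3 * a / 2 - 1)\<close>, the terms in \<open>kummerU a\<close> carry
      \<open>3 * a * x^2 * P\<close> from the prefactor and \<open>- 3 * a * (1 + x^2) * P\<close>
      from \<open>kummerU a\<close> itself, leaving \<open>- 3 * a * P\<close>.\<close>
    let ?g = "\<lambda>x. c * (3 * (a * (a + 1/3)) * ((1 + x\<^sup>2) powr (3 * a / 2) * kummerU (a + 1) (\<sigma> * x))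
        + - 3 * a * ((1 + x\<^sup>2) powr (3 * a / 2 - 1) * kummerU a (\<sigma> * x)))"
    have "symbol_class 2 (2 * (3 * a / 2) + - 3 * (a + 1)) (\<lambda>x. (1 + x\<^sup>2) powr (3 * a / 2) * kummerU (a + 1) (\<sigma> * x))"
      "symbol_class 2 (2 * (3 * a / 2 - 1) + - 3 * a) (\<lambda>x. (1 + x\<^sup>2) powr (3 * a / 2 - 1) * kummerU a (\<sigma> * x))"
      by (intro symbol_class_mult symbol_class_one_plus_square_powr U U1)+
    \<comment> \<open>The two orders are -3 and -2; the first is relaxed to -2.\<close>
    then have g: "symbol_class 2 (- 2) ?g"
      by (intro symbol_class_cmult symbol_class_add; elim symbol_class_mono) auto
    have dg: "((\<lambda>x. Lambda k (\<sigma> * x)) has_real_derivative ?g x / x) (at x)" if x: "x > 1" for x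
    proof -
      define P where "P = (1 + x\<^sup>2) powr (3 * a / 2 - 1)"
      define u where "u = kummerU a (\<sigma> * x)"
      define w where "w = 3 * (a * (a + 1/3)) * kummerU (a + 1) (\<sigma> * x)"
      have P: "(1 + x\<^sup>2) powr (3 * a / 2) = P * (1 + x\<^sup>2)"
        using powr_add[of "1 + x\<^sup>2" "3 * a / 2 - 1" 1] by (simp add: P_def add_nonneg_eq_0_iff)
      have "((\<lambda>x. Lambda k (\<sigma> * x)) has_real_derivative
          c * (2 * (3 * a / 2) * (x * P) * u + (w + - 3 * a * u) / x * (P * (1 + x\<^sup>2)))) (at x)"
        unfolding L \<sigma>2 P_def P[unfolded P_def, symmetric] u_def w_def
        by (intro DERIV_cmult DERIV_mult has_real_derivative_one_plus_square_powr kummerU_euler_derivative a')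
           (use x in auto)
      also have "c * (2 * (3 * a / 2) * (x * P) * u + (w + - 3 * a * u) / x * (P * (1 + x\<^sup>2)))
          = c * (P * (1 + x\<^sup>2) * w + - 3 * a * (P * u)) / x"
        using x by (simp add: field_simps power2_eq_square)
      also have "c * (P * (1 + x\<^sup>2) * w + - 3 * a * (P * u)) = ?g x"
        unfolding P by (simp add: P_def u_def w_def mult_ac)
      finally show ?thesis .
    qed
    obtain B where "\<And>x. x > 1 \<Longrightarrow> \<bar>x ^ 3 * f1 (\<sigma> * x)\<bar> + \<bar>x ^ 4 * f2 (\<sigma> * x)\<bar> + \<bar>x ^ 5 * f3 (\<sigma> * x)\<bar> \<le> B"
      using derivative_bounds_of_symbol_class[OF f1 f2 f3 \<sigma> dg g] by blast
    with A show ?thesis by (intro exI[of _ "A + B"] allI impI add_mono) auto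
  qed
  obtain C1 where C1: "\<And>x. x > 1 \<Longrightarrow> \<bar>Lambda k x\<bar> + (\<bar>x ^ 3 * f1 x\<bar> + \<bar>x ^ 4 * f2 x\<bar> + \<bar>x ^ 5 * f3 x\<bar>) \<le> C1"
    using bounds[of 1] by auto
  obtain C2 where C2: "\<And>x. x > 1 \<Longrightarrow> \<bar>Lambda k (- x)\<bar> + (\<bar>x ^ 3 * f1 (- x)\<bar> + \<bar>x ^ 4 * f2 (- x)\<bar> + \<bar>x ^ 5 * f3 (- x)\<bar>) \<le> C2"
    using bounds[of "-1"] by auto
  let ?S = "\<lambda>t. \<bar>Lambda k t\<bar> + (\<bar>t ^ 3 * f1 t\<bar> + \<bar>t ^ 4 * f2 t\<bar> + \<bar>t ^ 5 * f3 t\<bar>)"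
  \<comment> \<open>On the interval from -1 to 1 the whole sum is continuous, hence bounded;
    continuity of \<open>f3\<close> comes from the level 3 of \<open>Ck\<close>.\<close>
  have "continuous_on UNIV (Lambda k)" "continuous_on UNIV f1" "continuous_on UNIV f2"
    using f1 f2 f3 by (auto intro!: continuous_at_imp_continuous_on intro: DERIV_isCont)
  then have "continuous_on UNIV ?S" using cont by (intro continuous_intros)
  then have "compact (?S ` {-1..1})"
    by (intro compact_continuous_image) (auto intro: continuous_on_subset)
  then have "bounded (?S ` {-1..1})" by (rule compact_imp_bounded)
  then obtain C0 where C0: "\<forall>t\<in>{-1..1}. ?S t \<le> C0"
    unfolding bounded_iff by (metis (no_types, lifting) abs_ge_self image_eqI order_trans real_norm_def)
  \<comment> \<open>The entry 1 guarantees positivity.\<close>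
  define C where "C = max 1 (max C0 (max C1 C2))"
  have "?S t \<le> C" for t
  proof -
    consider "t \<in> {-1..1}" | "t > 1" | "- t > 1" by force
    then show ?thesis
    proof cases
      case 1
      then have "?S t \<le> C0" using C0 by blast
      then show ?thesis unfolding C_def by linarith
    next
      case 2
      then have "?S t \<le> C1" by (rule C1)
      then show ?thesis unfolding C_def by linarith
    next
      case 3
      \<comment> \<open>\<open>C2\<close> is applied at \<open>x = - t\<close>; the absolute values
        hide the sign of the odd powers.\<close>
      from C2[OF 3] have "?S t \<le> C2" by (simp add: abs_mult power_abs)
      then show ?thesis unfolding C_def by linarith
    qed
  qed
  moreover have "C > 0" unfolding C_def by simp
  ultimately show ?thesis unfolding dd d1 by (intro exI[of _ C]) (auto simp: add.assoc)
qed

end
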